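(* Let $E_1\subset E_2$ be subsets of the unit circle $T=\{z\in\mathbb{C}:|z|=1\}$, and assume that $E_2$ is of measure zero. Then there exists a Blaschke product $B$ such that the radial limits of $B$ fail to exist precisely at the points of $E_1$ and $B$ has unrestricted limits precisely at the points of $T\setminus E_2$, if and only if $E_2$ is closed and $E_1$ is of type $G_{\delta\sigma}$ and of measure zero.
   Context: $D=\{z\in\mathbb{C}:|z|<1\}$ is the open unit disc; measure on $T$ is Lebesgue (arc-length) measure. A Blaschke product is an infinite product of the form $$B(z)=\prod_{n=1}^{\infty}\frac{|a_n|}{a_n}\cdot\frac{a_n-z}{1-\overline{a_n}\,z},\qquad z\in D,$$ where $\{a_n\}_{n=1}^\infty$ is an infinite sequence of points of $D$ with $\sum_{n=1}^\infty(1-|a_n|)<\infty$. For $\zeta\in T$, the radial limit of $B$ at $\zeta$ is $\lim_{r\to1^-}B(r\zeta)$ (when it exists). The function $B$ has an unrestricted limit $L\in\mathbb{C}$ at $\zeta$ if $B(z)\to L$ as $z\to\zeta$ with $z\in D$ (no restriction on the manner of approach within $D$). A subset of $T$ is of type $G_\delta$ if it is a countable intersection of (relatively) open subsets of $T$, and of type $G_{\delta\sigma}$ if it is a countable union of sets of type $G_\delta$.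
   Formalization: The formal theorem assumes in addition that E_2 is nonempty: for E_2 empty the claim fails, since the infinitely many zeros of a Blaschke product accumulate at a point of T, where an unrestricted limit would be 0 although it must have modulus 1. *)

theory Defs
  imports "HOL-Analysis.Analysis"
begin

text \<open>
  The factor for \<open>a = 0\<close> is \<open>z\<close>, the usual convention (\<open>\<bar>a\<bar> / a\<close> is read as \<open>-1\<close> there);
  without the case distinction, division by zero would make the whole product vanish.
\<close>

definition blaschke_factor :: "complex \<Rightarrow> complex \<Rightarrow> complex" where
  "blaschke_factor a z =
     (if a = 0 then z
      else complex_of_real (norm a) / a * ((a - z) / (1 - cnj a * z)))"

text \<open>
  The zero sequence is infinite, so finite products do not count as Blaschke products. The zeros
  of \<open>B\<close> therefore accumulate somewhere on the circle, and \<open>B\<close> cannot have unrestricted limits at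
  every point of it. Only the values of \<open>B\<close> on the open unit disc matter.
\<close>

definition is_blaschke_product :: "(complex \<Rightarrow> complex) \<Rightarrow> bool" where
  "is_blaschke_product B \<longleftrightarrow>
     (\<exists>a :: nat \<Rightarrow> complex.
        (\<forall>n. norm (a n) < 1) \<and>
        summable (\<lambda>n. 1 - norm (a n)) \<and>
        (\<forall>z \<in> ball 0 1. B z = (\<Prod>n. blaschke_factor (a n) z)))"

definition has_radial_limit_at :: "(complex \<Rightarrow> complex) \<Rightarrow> complex \<Rightarrow> bool" where
  "has_radial_limit_at B \<zeta> \<longleftrightarrow>
     (\<exists>L. ((\<lambda>r. B (complex_of_real r * \<zeta>)) \<longlongrightarrow> L) (at_left 1))"

definition has_unrestricted_limit_at :: "(complex \<Rightarrow> complex) \<Rightarrow> complex \<Rightarrow> bool" where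
  "has_unrestricted_limit_at B \<zeta> \<longleftrightarrow> (\<exists>L. (B \<longlongrightarrow> L) (at \<zeta> within ball 0 1))"

text \<open>
  Arc length on the unit circle is the image of Lebesgue measure under the parametrization
  \<open>cis\<close> of one period; completing it makes every subset of a null set measurable.
\<close>

definition arc_length :: "complex measure" where
  "arc_length =
     completion (distr (restrict_space lborel {0..<2 * pi})
                       (restrict_space borel (sphere 0 1)) cis)"

definition gdelta_sigma_in :: "'a topology \<Rightarrow> 'a set \<Rightarrow> bool" where
  "gdelta_sigma_in X = (countable union_of gdelta_in X)"

end

theory Submission
  imports Defs "HOL-Complex_Analysis.Complex_Analysis"
begin

text \<open>
  An unrestricted limit \<open>L\<close> of a Blaschke product at \<open>\<zeta>\<close> has modulus 1, so the zeros stay away from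
  \<open>\<zeta>\<close> and the product extends continuously to a neighbourhood of \<open>\<zeta>\<close>; hence \<open>E2\<close> is closed. The
  Cauchy criterion shows that the points without radial limit form a set of type G-delta-sigma.

  Conversely, let \<open>E2\<close> be closed and null. Since \<open>E2\<close> is compact and null, roots of unity of high
  order near \<open>E2\<close> are relatively few, so one can put a zero close to each of them with small
  Blaschke sum. Doing this on a rapidly decreasing sequence of scales makes \<open>B\<close> tend
  to 0 radially on \<open>E2\<close>, at a rate governed by weights that can be chosen freely on each scale. The
  weights tend to infinity at the points of \<open>E2 - E1\<close>, but for each point of \<open>E1\<close> some bounded weight
  is used on infinitely many scales, which keeps \<open>\<bar>B\<bar>\<close> away from 0 along a sequence of radii.
  Controlling only the modulus of \<open>B\<close> suffices, because the radial limit on \<open>E2 - E1\<close> is 0.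
\<close>

text \<open>At distance \<open>r\<close> from the circle, \<open>N\<close> zeros of depth
  \<open>w / N\<close> below equally spaced points have a Poisson sum of about
  \<open>(N * r) * (w / N) / r = w\<close>, whatever \<open>r\<close> is, as long as it is large
  compared with \<open>1 / N\<close>. Hence one weight controls a whole range of radii, and the
  ranges of consecutive levels cover all radii close to 1. The obstacle is the matching lower bound
  for the modulus. It comes from an exact identity: the factors of a full uniform mesh multiply up
  to one factor in the \<open>N\<close>-th power of \<open>z\<close>, whose modulus is about
  \<open>(1 - w / N)^N\<close>, comparable with a power of \<open>exp (- w)\<close>, at radii where
  the \<open>N\<close>-th power of \<open>z\<close> is negligible. This is why the zeros sit below
  roots of unity and why the weight is kept constant around each point of \<open>F k\<close>. At a
  point of \<open>E1\<close> two sequences of radii collide. The levels with \<open>F k = {}\<close>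
  carry the full weight \<open>k + 1\<close> and leave 0 as the only possible radial limit, while
  the levels with a fixed weight at that point exclude 0.\<close>

section \<open>Blaschke factors and products\<close>

text \<open>One minus the squared pseudohyperbolic distance of \<open>a\<close> and
  \<open>z\<close>. For \<open>a\<close> near the circle it is about
  \<open>1 - (norm a)\<^sup>2\<close> times the Poisson kernel, so sums of defects take the place of
  Poisson sums.\<close>

definition blaschke_defect :: "complex \<Rightarrow> complex \<Rightarrow> real" where
  "blaschke_defect a z = (1 - (norm z)\<^sup>2) * (1 - (norm a)\<^sup>2) / (norm (1 - cnj a * z))\<^sup>2"

lemma one_minus_cnj_mult_nonzero:
  assumes "norm a < 1" "norm z \<le> 1"
  shows "1 - cnj a * z \<noteq> 0"
proof
  assume "1 - cnj a * z = 0"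
  then have "norm a * norm z = 1"
    by (metis complex_mod_cnj eq_iff_diff_eq_0 norm_mult norm_one)
  moreover have "norm a * norm z < 1"
    using assms by (metis mult_left_le norm_ge_zero order_le_less_trans)
  ultimately show False by simp
qed

lemma norm_blaschke_factor_squared:
  assumes "norm a < 1" "norm z \<le> 1"
  shows "(norm (blaschke_factor a z))\<^sup>2 = 1 - blaschke_defect a z"
proof -
  have nz: "norm (1 - cnj a * z) \<noteq> 0"
    using one_minus_cnj_mult_nonzero[OF assms] by simp
  have key: "(norm (1 - cnj a * z))\<^sup>2 - (norm (a - z))\<^sup>2 = (1 - (norm z)\<^sup>2) * (1 - (norm a)\<^sup>2)"
    unfolding cmod_power2 by (simp add: algebra_simps power2_eq_square)
  have "(norm (blaschke_factor a z))\<^sup>2 = (norm (a - z))\<^sup>2 / (norm (1 - cnj a * z))\<^sup>2"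
    by (auto simp: blaschke_factor_def norm_mult norm_divide power_divide power_mult_distrib)
  also have "\<dots> = 1 - blaschke_defect a z"
    using nz key by (simp add: blaschke_defect_def field_simps)
  finally show ?thesis .
qed

lemma blaschke_defect_nonneg:
  assumes "norm a < 1" "norm z \<le> 1"
  shows "blaschke_defect a z \<ge> 0"
  using assms by (simp add: blaschke_defect_def power_le_one)

lemma blaschke_defect_le_1:
  assumes "norm a < 1" "norm z \<le> 1"
  shows "blaschke_defect a z \<le> 1"
  using norm_blaschke_factor_squared[OF assms] zero_le_power2[of "norm (blaschke_factor a z)"] by linarith

lemma norm_blaschke_factor_le_1:
  assumes "norm a < 1" "norm z \<le> 1"
  shows "norm (blaschke_factor a z) \<le> 1"
  by (rule power2_le_imp_le)
     (use norm_blaschke_factor_squared[OF assms] blaschke_defect_nonneg[OF assms] in auto)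

lemma blaschke_factor_self: "blaschke_factor a a = 0"
  by (simp add: blaschke_factor_def)

lemma norm_blaschke_factor_0: "norm (blaschke_factor a 0) = norm a"
  by (simp add: blaschke_factor_def norm_mult norm_divide)

text \<open>Clearing denominators leaves the factor \<open>1 - norm a\<close>, through which the
  Blaschke condition gives convergence. Only the pole is excluded, because the product is also
  needed across the circle.\<close>

lemma norm_blaschke_factor_minus_1:
  assumes "norm a < 1" and nz: "1 - cnj a * z \<noteq> 0"
  shows "norm (blaschke_factor a z - 1) \<le> (1 - norm a) * (1 + norm z) / norm (1 - cnj a * z)"
proof (cases "a = 0")
  case True
  then show ?thesis
    using norm_triangle_ineq4[of z 1] by (simp add: blaschke_factor_def)
next
  case False
  have sq: "complex_of_real (norm a) * complex_of_real (norm a) = a * cnj a"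
    using complex_norm_square[of a] by (simp add: power2_eq_square)
  have "a * (1 - cnj a * z) * blaschke_factor a z = complex_of_real (norm a) * (a - z)"
    using False nz by (simp add: blaschke_factor_def)
  then have "a * (1 - cnj a * z) * (blaschke_factor a z - 1)
      = complex_of_real (norm a) * (a - z) - a * (1 - cnj a * z)"
    by (simp add: right_diff_distrib)
  also have "\<dots> = - (complex_of_real (1 - norm a) * (a + complex_of_real (norm a) * z))"
    using sq by (simp add: algebra_simps)
  finally have "norm (a * (1 - cnj a * z) * (blaschke_factor a z - 1))
      = norm (complex_of_real (1 - norm a) * (a + complex_of_real (norm a) * z))"
    by simp
  then have "norm a * norm (1 - cnj a * z) * norm (blaschke_factor a z - 1)
      = (1 - norm a) * norm (a + complex_of_real (norm a) * z)"
    using assms(1) by (simp only: norm_mult norm_of_real)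
  also have "norm (a + complex_of_real (norm a) * z) \<le> norm a * (1 + norm z)"
    by (metis (no_types, opaque_lifting) abs_norm_cancel distrib_left mult.right_neutral norm_mult norm_of_real norm_triangle_ineq)
  finally have "norm a * (norm (1 - cnj a * z) * norm (blaschke_factor a z - 1))
      \<le> norm a * ((1 - norm a) * (1 + norm z))"
    using assms(1) by (simp add: mult_left_mono mult_ac)
  then have "norm (1 - cnj a * z) * norm (blaschke_factor a z - 1) \<le> (1 - norm a) * (1 + norm z)"
    using False by (subst (asm) mult_le_cancel_left_pos) auto
  then show ?thesis using nz by (simp add: le_divide_eq mult.commute)
qed

locale blaschke_zeros =
  fixes a :: "nat \<Rightarrow> complex"
  assumes norm_zero_less_1: "norm (a n) < 1"
    and summable_zeros: "summable (\<lambda>n. 1 - norm (a n))"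
begin

definition prod_at :: "complex \<Rightarrow> complex" where
  "prod_at z = (\<Prod>n. blaschke_factor (a n) z)"

text \<open>The Weierstrass test with majorant \<open>(1 - norm (a n)) * (3 / d)\<close>, where 3
  bounds \<open>1 + norm z\<close>. As \<open>A\<close> may reach beyond the circle, this serves
  compact parts of the disc and neighbourhoods of boundary points alike.\<close>

lemma uniform_limit_prod_at:
  assumes A: "compact A" "A \<subseteq> cball 0 2" and d: "d > 0"
    and far: "\<And>n z. z \<in> A \<Longrightarrow> d \<le> norm (1 - cnj (a n) * z)"
  shows "uniform_limit A (\<lambda>n z. \<Prod>k<n. blaschke_factor (a k) z) prod_at sequentially"
proof -
  have nz: "1 - cnj (a n) * z \<noteq> 0" if "z \<in> A" for n z
    using far[OF that, of n] d by auto
  have le: "norm (blaschke_factor (a n) z - 1) \<le> (1 - norm (a n)) * (3 / d)" if "z \<in> A" for n z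
  proof -
    have "norm (blaschke_factor (a n) z - 1) \<le> (1 - norm (a n)) * (1 + norm z) / norm (1 - cnj (a n) * z)"
      by (rule norm_blaschke_factor_minus_1[OF norm_zero_less_1 nz[OF that]])
    also have "\<dots> \<le> (1 - norm (a n)) * 3 / d"
      using far[OF that, of n] d that A(2) norm_zero_less_1[of n]
      by (intro frac_le mult_mono) (auto simp: less_imp_le)
    finally show ?thesis by simp
  qed
  have sm: "summable (\<lambda>n. (1 - norm (a n)) * (3 / d))"
    by (intro summable_mult2 summable_zeros)
  have "uniformly_convergent_on A (\<lambda>N z. \<Prod>n<N. blaschke_factor (a n) z)"
  proof (rule uniformly_convergent_on_prod'[OF _ A(1)])
    show "continuous_on A (blaschke_factor (a n))" for n
      using nz by (cases "a n = 0") (auto simp: blaschke_factor_def[abs_def] intro!: continuous_intros)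
    show "uniformly_convergent_on A (\<lambda>N x. \<Sum>n<N. norm (blaschke_factor (a n) x - 1))"
      by (rule Weierstrass_m_test'[OF _ sm]) (use le in auto)
  qed
  then obtain f where f: "uniform_limit A (\<lambda>n z. \<Prod>k<n. blaschke_factor (a k) z) f sequentially"
    by (auto simp: uniformly_convergent_on_def)
  have "f z = prod_at z" if "z \<in> A" for z
  proof -
    have "summable (\<lambda>n. norm (blaschke_factor (a n) z - 1))"
      by (rule summable_comparison_test'[OF sm, of 0]) (use le[OF that] in auto)
    then have "convergent_prod (\<lambda>n. blaschke_factor (a n) z)"
      by (simp add: abs_convergent_prod_conv_summable abs_convergent_prod_imp_convergent_prod)
    then have "(\<lambda>n. \<Prod>k\<le>n. blaschke_factor (a k) z) \<longlonglongrightarrow> prod_at z"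
      unfolding prod_at_def by (rule convergent_prod_LIMSEQ)
    moreover have "(\<lambda>n. \<Prod>k<n. blaschke_factor (a k) z) \<longlonglongrightarrow> f z"
      using tendsto_uniform_limitI[OF f that] .
    then have "(\<lambda>n. \<Prod>k\<le>n. blaschke_factor (a k) z) \<longlonglongrightarrow> f z"
      by (auto simp only: lessThan_Suc_atMost[symmetric] dest: LIMSEQ_Suc)
    ultimately show ?thesis using LIMSEQ_unique by blast
  qed
  then show ?thesis
    using f by (simp add: uniform_limit_iff)
qed

lemma far_in_disc:
  assumes "norm z \<le> r" "r < 1"
  shows "1 - r \<le> norm (1 - cnj (a n) * z)"
proof -
  have "norm (cnj (a n) * z) \<le> 1 * r"
    unfolding norm_mult using assms norm_zero_less_1[of n]
    by (intro mult_mono) (auto simp: less_imp_le)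
  then show ?thesis using norm_triangle_ineq2[of 1 "cnj (a n) * z"] by simp
qed

lemma uniform_limit_prod_at_cball:
  assumes "r < 1"
  shows "uniform_limit (cball 0 r) (\<lambda>n z. \<Prod>k<n. blaschke_factor (a k) z) prod_at sequentially"
  by (rule uniform_limit_prod_at[where d = "1 - r"])
     (use assms far_in_disc in \<open>auto simp: dist_norm\<close>)

lemma prod_at_LIMSEQ:
  assumes "norm z < 1"
  shows "(\<lambda>n. \<Prod>k<n. blaschke_factor (a k) z) \<longlonglongrightarrow> prod_at z"
  using tendsto_uniform_limitI[OF uniform_limit_prod_at_cball[OF assms], of z] by simp

lemma holomorphic_blaschke_factor: "blaschke_factor (a n) holomorphic_on ball 0 1"
proof -
  have "1 - cnj (a n) * z \<noteq> 0" if "norm z < 1" for z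
    using one_minus_cnj_mult_nonzero[OF norm_zero_less_1] that by auto
  then show ?thesis
    by (cases "a n = 0") (auto simp: blaschke_factor_def[abs_def] intro!: holomorphic_intros)
qed

lemma holomorphic_prod_at: "prod_at holomorphic_on ball 0 1"
proof (rule holomorphic_uniform_sequence)
  show "(\<lambda>z. \<Prod>k<n. blaschke_factor (a k) z) holomorphic_on ball 0 1" for n
    by (intro holomorphic_intros holomorphic_blaschke_factor)
  show "\<exists>d>0. cball z d \<subseteq> ball 0 1 \<and>
      uniform_limit (cball z d) (\<lambda>n z. \<Prod>k<n. blaschke_factor (a k) z) prod_at sequentially"
    if z: "z \<in> ball 0 1" for z
  proof (intro exI conjI)
    define d where "d = (1 - norm z) / 2"
    show "d > 0" using z by (simp add: d_def)
    have sub: "cball z d \<subseteq> cball 0 (norm z + d)"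
      by (metis add.commute cball_subset_cball_iff dist_0_norm dist_commute order_refl)
    moreover have lt: "norm z + d < 1" using z by (simp add: d_def field_simps)
    ultimately show "cball z d \<subseteq> ball 0 1" by fastforce
    show "uniform_limit (cball z d) (\<lambda>n z. \<Prod>k<n. blaschke_factor (a k) z) prod_at sequentially"
      by (rule uniform_limit_on_subset[OF uniform_limit_prod_at_cball[OF lt] sub])
  qed
qed simp

lemma norm_prod_at_le:
  assumes z: "norm z < 1" and "finite S"
  shows "norm (prod_at z) \<le> (\<Prod>k\<in>S. norm (blaschke_factor (a k) z))"
proof (rule LIMSEQ_le_const2[OF tendsto_norm[OF prod_at_LIMSEQ[OF z]]])
  obtain M where M: "S \<subseteq> {..<M}"
    using finite_nat_iff_bounded assms(2) by blast
  have "norm (\<Prod>k<n. blaschke_factor (a k) z) \<le> (\<Prod>k\<in>S. norm (blaschke_factor (a k) z))"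
    if "n \<ge> M" for n
  proof -
    have le1: "norm (blaschke_factor (a k) z) \<le> 1" for k
      using z by (intro norm_blaschke_factor_le_1 norm_zero_less_1) simp
    have "S \<subseteq> {..<n}" using M that by auto
    then have "norm (\<Prod>k<n. blaschke_factor (a k) z)
        = (\<Prod>k\<in>{..<n} - S. norm (blaschke_factor (a k) z)) * (\<Prod>k\<in>S. norm (blaschke_factor (a k) z))"
      by (simp add: prod.subset_diff norm_mult prod_norm)
    also have "\<dots> \<le> 1 * (\<Prod>k\<in>S. norm (blaschke_factor (a k) z))"
      using le1 by (intro mult_right_mono prod_le_1 prod_nonneg) auto
    finally show ?thesis by simp
  qed
  then show "\<exists>M. \<forall>n\<ge>M. norm (\<Prod>k<n. blaschke_factor (a k) z) \<le> (\<Prod>k\<in>S. norm (blaschke_factor (a k) z))"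
    by blast
qed

lemma norm_prod_at_le_1: "norm z < 1 \<Longrightarrow> norm (prod_at z) \<le> 1"
  using norm_prod_at_le[of z "{}"] by simp

lemma prod_at_zero: "prod_at (a n) = 0"
  using norm_prod_at_le[of "a n" "{n}"] norm_zero_less_1[of n] by (simp add: blaschke_factor_self)

end

section \<open>Roots of unity as a mesh on the circle\<close>

definition mesh_point :: "nat \<Rightarrow> nat \<Rightarrow> complex" where
  "mesh_point N q = cis (2 * pi * real q / real N)"

lemma norm_mesh_point [simp]: "norm (mesh_point N q) = 1"
  by (simp add: mesh_point_def)

lemma norm_cis_diff_le: "norm (cis x - cis y) \<le> \<bar>x - y\<bar>"
proof -
  have "cis x - cis y = cis y * (cis (x - y) - 1)"
    by (simp add: right_diff_distrib cis_mult)
  then have "norm (cis x - cis y) = norm (exp (\<i> * of_real (x - y)) - 1)"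
    by (simp add: norm_mult cis_conv_exp)
  also have "\<dots> = 2 * \<bar>sin ((x - y) / 2)\<bar>"
    by (rule dist_exp_i_1)
  also have "\<dots> \<le> 2 * \<bar>(x - y) / 2\<bar>"
    by (intro mult_left_mono abs_sin_x_le_abs_x) simp
  finally show ?thesis by simp
qed

lemma unit_complex_as_cis:
  assumes "norm z = 1"
  obtains x where "0 \<le> x" "x < 2 * pi" "z = cis x"
  using that[of "Arg2pi z"] Arg2pi[of z] assms by (simp add: cis_conv_exp is_Arg_def)

text \<open>An arc of length \<open>s\<close> with one end at \<open>z\<close> has room for
  \<open>h = N * s / (2 * pi)\<close> mesh points. Since \<open>2 * pi < 7\<close>, \<open>h\<close>
  is at least 1, so rounding down loses at most a factor 2, and \<open>4 * pi < 16\<close> gives the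
  constant.\<close>

lemma card_mesh_near_ge:
  assumes z: "norm z = 1" and s: "0 < s" "s \<le> 1" and Ns: "7 \<le> real N * s"
  shows "real N * s / 16 \<le> card {q. q < N \<and> norm (mesh_point N q - z) \<le> s}"
proof -
  obtain x where x: "0 \<le> x" "x < 2 * pi" "z = cis x"
    using unit_complex_as_cis[OF z] .
  \<comment> \<open>The arc lies on the side of \<open>x\<close> on which it does not cross the
    angle 0, so the indices \<open>q\<close> do not wrap around.\<close>
  define y where "y = (if x \<le> pi then x else x - s)"
  have y: "0 \<le> y" "y + s \<le> 2 * pi" "y \<le> x" "x \<le> y + s"
    using x s pi_gt3 by (auto simp: y_def)
  define u where "u = real N * y / (2 * pi)"
  define h where "h = real N * s / (2 * pi)"
  have N: "N > 0" using Ns by (cases N) auto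
  have u0: "u \<ge> 0" using y by (simp add: u_def)
  have "2 * pi \<le> 7" using pi_approx by simp
  then have h1: "h \<ge> 1" using Ns by (simp add: h_def le_divide_eq)
  define q0 where "q0 = nat \<lceil>u\<rceil>"
  define k where "k = nat \<lfloor>h\<rfloor>"
  have q0: "u \<le> real q0" "real q0 < u + 1"
    using u0 by (auto simp: q0_def) linarith+
  have k: "real k \<le> h" "h < real k + 1" using h1 by (auto simp: k_def)
  have "{q0..<q0 + k} \<subseteq> {q. q < N \<and> norm (mesh_point N q - z) \<le> s}"
  proof (clarify, intro conjI)
    fix q assume "q \<in> {q0..<q0 + k}"
    then have "real q0 \<le> real q" "real q + 1 \<le> real q0 + real k" by auto
    with q0 k have q: "u \<le> real q" "real q < u + h" by linarith+
    have uh: "u + h = real N * (y + s) / (2 * pi)"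
      by (simp add: u_def h_def add_divide_distrib distrib_left)
    also have "\<dots> \<le> real N * (2 * pi) / (2 * pi)"
      using y by (intro divide_right_mono mult_left_mono) auto
    finally show "q < N" using q by simp
    have "y \<le> 2 * pi * real q / real N"
      using q(1) N by (simp add: u_def field_simps)
    moreover have "2 * pi * real q / real N \<le> y + s"
      using q(2) N unfolding uh by (simp add: field_simps)
    ultimately have "\<bar>2 * pi * real q / real N - x\<bar> \<le> s" using y by linarith
    then show "norm (mesh_point N q - z) \<le> s"
      unfolding mesh_point_def x(3) by (rule order_trans[OF norm_cis_diff_le])
  qed
  then have "card {q0..<q0 + k} \<le> card {q. q < N \<and> norm (mesh_point N q - z) \<le> s}"
    by (rule card_mono[rotated]) auto
  then have "real k \<le> card {q. q < N \<and> norm (mesh_point N q - z) \<le> s}" by simp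
  moreover have "k \<ge> 1" using h1 by (simp add: k_def le_nat_iff)
  then have "h / 2 \<le> real k" using k by linarith
  moreover have "real N * s / 16 \<le> h / 2"
  proof -
    have "real N * s / 16 \<le> real N * s / (2 * pi * 2)"
      using s pi_less_4 by (intro divide_left_mono) auto
    then show ?thesis by (simp add: h_def)
  qed
  ultimately show ?thesis by linarith
qed

lemma mesh_rotation_near:
  assumes "norm w = 1" "norm \<zeta> = 1" "0 < s" "s \<le> 1" "7 \<le> real N * s"
  obtains q where "q < N" "norm (mesh_point N q * w - \<zeta>) \<le> s"
proof -
  have "real N * s / 16 \<le> card {q. q < N \<and> norm (mesh_point N q - \<zeta> / w) \<le> s}"
    using assms by (intro card_mesh_near_ge) (auto simp: norm_divide)
  then have "card {q. q < N \<and> norm (mesh_point N q - \<zeta> / w) \<le> s} \<noteq> 0"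
    using assms by (intro notI) simp
  then have "{q. q < N \<and> norm (mesh_point N q - \<zeta> / w) \<le> s} \<noteq> {}"
    by (intro notI) simp
  then obtain q where q: "q < N" "norm (mesh_point N q - \<zeta> / w) \<le> s"
    by blast
  have "w \<noteq> 0" using assms by auto
  then have "mesh_point N q * w - \<zeta> = (mesh_point N q - \<zeta> / w) * w"
    by (simp add: left_diff_distrib)
  then have "norm (mesh_point N q * w - \<zeta>) \<le> s"
    using q assms by (simp add: norm_mult)
  with q that show thesis by blast
qed

lemma norm_one_minus_cnj_mult_unit:
  assumes "norm \<zeta> = 1"
  shows "norm (1 - cnj b * \<zeta>) = norm (b - \<zeta>)"
proof -
  have "1 = cnj \<zeta> * \<zeta>"
    using assms complex_norm_square[of \<zeta>] by (simp add: mult.commute)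
  then have "1 - cnj b * \<zeta> = cnj (\<zeta> - b) * \<zeta>" by (simp add: left_diff_distrib)
  then have "norm (1 - cnj b * \<zeta>) = norm (\<zeta> - b)"
    using assms by (simp only: norm_mult complex_mod_cnj)
  then show ?thesis by (simp add: norm_minus_commute)
qed

section \<open>Boundary limits from the position of the zeros, and tails of the product\<close>

context blaschke_zeros
begin

text \<open>For \<zeta> on the circle, \<open>norm (1 - cnj (a n) * \<zeta>)\<close> is the distance
  from \<open>a n\<close> to \<zeta>. So all denominators are at least \<open>d / 2\<close> on a
  full disc about \<zeta>, and the product is continuous across the circle there.\<close>

lemma unrestricted_limit_if_zeros_far:
  assumes z: "norm \<zeta> = 1" and d: "d > 0" and far: "\<And>n. d \<le> norm (a n - \<zeta>)"
  shows "has_unrestricted_limit_at prod_at \<zeta>"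
proof -
  let ?A = "cball \<zeta> (d / 2)"
  have "d \<le> 2"
    using far[of 0] norm_triangle_ineq4[of "a 0" \<zeta>] z norm_zero_less_1[of 0] by linarith
  have sub: "?A \<subseteq> cball 0 2"
  proof
    fix x assume "x \<in> ?A"
    then have "norm (x - \<zeta>) \<le> 1" using \<open>d \<le> 2\<close> by (simp add: dist_norm norm_minus_commute)
    then show "x \<in> cball 0 2" using z norm_triangle_sub[of x \<zeta>] by simp
  qed
  have far': "d / 2 \<le> norm (1 - cnj (a n) * x)" if "x \<in> ?A" for n x
  proof -
    have "norm (cnj (a n) * (x - \<zeta>)) \<le> 1 * (d / 2)"
      unfolding norm_mult using that norm_zero_less_1[of n]
      by (intro mult_mono) (auto simp: dist_norm norm_minus_commute less_imp_le)
    moreover have "1 - cnj (a n) * \<zeta> = (1 - cnj (a n) * x) + cnj (a n) * (x - \<zeta>)"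
      by (simp add: algebra_simps)
    then have "norm (1 - cnj (a n) * \<zeta>) \<le> norm (1 - cnj (a n) * x) + norm (cnj (a n) * (x - \<zeta>))"
      using norm_triangle_ineq by metis
    ultimately show ?thesis
      using far[of n] norm_one_minus_cnj_mult_unit[OF z, of "a n"] by simp
  qed
  have "uniform_limit ?A (\<lambda>n z. \<Prod>k<n. blaschke_factor (a k) z) prod_at sequentially"
    by (rule uniform_limit_prod_at[OF _ sub _ far']) (use d in auto)
  moreover have "continuous_on ?A (\<lambda>z. \<Prod>k<n. blaschke_factor (a k) z)" for n
  proof (intro continuous_on_prod)
    have "1 - cnj (a k) * x \<noteq> 0" if "x \<in> ?A" for k x
      using far'[OF that, of k] d by auto
    then show "continuous_on ?A (blaschke_factor (a k))" for k
      by (cases "a k = 0") (auto simp: blaschke_factor_def[abs_def] intro!: continuous_intros)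
  qed
  ultimately have "continuous_on ?A prod_at"
    by (intro uniform_limit_theorem) auto
  then have "isCont prod_at \<zeta>"
    using d by (intro continuous_on_interior[of ?A]) (auto simp: interior_cball)
  then show ?thesis
    unfolding has_unrestricted_limit_at_def isCont_def by (meson Lim_at_imp_Lim_at_within)
qed

lemma unrestricted_limit_if_finitely_many_near:
  assumes z: "norm \<zeta> = 1" and d: "d > 0" and fin: "finite {n. norm (a n - \<zeta>) < d}"
  shows "has_unrestricted_limit_at prod_at \<zeta>"
proof -
  let ?D = "insert d ((\<lambda>n. norm (a n - \<zeta>)) ` {n. norm (a n - \<zeta>) < d})"
  have fD: "finite ?D" using fin by simp
  have "norm (a n - \<zeta>) > 0" for n using norm_zero_less_1[of n] z by auto
  then have pos: "Min ?D > 0" using fD d by (subst Min_gr_iff) auto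
  have "Min ?D \<le> norm (a n - \<zeta>)" for n
  proof (cases "norm (a n - \<zeta>) < d")
    case True
    then show ?thesis by (intro Min_le fD) auto
  next
    case False
    have "Min ?D \<le> d" by (intro Min_le fD) auto
    with False show ?thesis by linarith
  qed
  from unrestricted_limit_if_zeros_far[OF z pos this] show ?thesis .
qed

lemma tail: "blaschke_zeros (\<lambda>n. a (n + M))"
  by unfold_locales (use norm_zero_less_1 in \<open>auto intro!: summable_ignore_initial_segment summable_zeros\<close>)

lemma prod_at_split:
  assumes z: "norm z < 1"
  shows "prod_at z = (\<Prod>k<M. blaschke_factor (a k) z) * blaschke_zeros.prod_at (\<lambda>n. a (n + M)) z"
proof -
  interpret T: blaschke_zeros "\<lambda>n. a (n + M)" by (rule tail)
  have "(\<lambda>n. (\<Prod>k<M. blaschke_factor (a k) z) * (\<Prod>k<n. blaschke_factor (a (k + M)) z))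
      \<longlonglongrightarrow> (\<Prod>k<M. blaschke_factor (a k) z) * T.prod_at z"
    by (intro tendsto_mult tendsto_const T.prod_at_LIMSEQ z)
  moreover have "(\<Prod>k<M. blaschke_factor (a k) z) * (\<Prod>k<n. blaschke_factor (a (k + M)) z)
      = (\<Prod>k<n + M. blaschke_factor (a k) z)" for n
    by (induction n) (simp_all add: mult.assoc[symmetric])
  ultimately have "(\<lambda>n. \<Prod>k<n + M. blaschke_factor (a k) z)
      \<longlonglongrightarrow> (\<Prod>k<M. blaschke_factor (a k) z) * T.prod_at z" by simp
  moreover have "(\<lambda>n. \<Prod>k<n + M. blaschke_factor (a k) z) \<longlonglongrightarrow> prod_at z"
    using LIMSEQ_ignore_initial_segment[OF prod_at_LIMSEQ[OF z]] .
  ultimately show ?thesis using LIMSEQ_unique by blast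
qed

text \<open>At 0 the factors have modulus \<open>norm (a n)\<close>, and the Weierstrass product
  inequality applies. For tails of the product the lower bound tends to 1.\<close>

lemma norm_prod_at_0_ge: "1 - (\<Sum>n. 1 - norm (a n)) \<le> norm (prod_at 0)"
proof (rule LIMSEQ_le_const[OF tendsto_norm[OF prod_at_LIMSEQ]])
  have "1 - (\<Sum>n. 1 - norm (a n)) \<le> norm (\<Prod>k<n. blaschke_factor (a k) 0)" for n
  proof -
    have "(\<Sum>k<n. 1 - norm (a k)) \<le> (\<Sum>n. 1 - norm (a n))"
      using norm_zero_less_1 by (intro sum_le_suminf summable_zeros) (auto simp: less_imp_le)
    moreover have "1 - (\<Sum>k<n. 1 - norm (a k)) \<le> (\<Prod>k<n. 1 - (1 - norm (a k)))"
      using norm_zero_less_1 by (intro Weierstrass_prod_ineq) (auto simp: less_imp_le)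
    ultimately show ?thesis by (simp add: prod_norm[symmetric] norm_blaschke_factor_0)
  qed
  then show "\<exists>N. \<forall>n\<ge>N. 1 - (\<Sum>n. 1 - norm (a n)) \<le> norm (\<Prod>k<n. blaschke_factor (a k) 0)"
    by blast
qed simp

text \<open>A finite Blaschke product has modulus 1 on the circle. Each defect is at most a constant
  times \<open>1 - r\<^sup>2\<close>, which makes the approach to 1 uniform in the direction of
  \<open>z\<close>.\<close>

lemma norm_partial_prod_near_1:
  assumes e: "e < 1"
  shows "eventually (\<lambda>r. \<forall>z. norm z = r \<longrightarrow> e < (norm (\<Prod>k<M. blaschke_factor (a k) z))\<^sup>2) (at_left 1)"
proof -
  let ?f = "\<lambda>r. 1 - (\<Sum>k<M. (1 - r\<^sup>2) / (1 - norm (a k))\<^sup>2)"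
  have "(?f \<longlongrightarrow> 1 - (\<Sum>k<M. (1 - 1\<^sup>2) / (1 - norm (a k))\<^sup>2)) (at_left (1::real))"
    using norm_zero_less_1 by (intro tendsto_intros) (auto simp: less_le)
  then have "(?f \<longlongrightarrow> 1) (at_left (1::real))" by simp
  then have "eventually (\<lambda>r. e < ?f r) (at_left 1)"
    using e by (rule order_tendstoD)
  moreover have "eventually (\<lambda>r::real. r \<in> {0<..<1}) (at_left 1)"
    by (rule eventually_at_left_real) simp
  ultimately show ?thesis
  proof eventually_elim
    case (elim r)
    show ?case
    proof (intro allI impI)
      fix z :: complex assume z: "norm z = r"
      have le: "blaschke_defect (a k) z \<le> (1 - r\<^sup>2) / (1 - norm (a k))\<^sup>2" for k
      proof -
        have "1 - norm (a k) \<le> norm (1 - cnj (a k) * z)"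
        proof -
          have "norm (cnj (a k) * z) \<le> norm (a k) * 1"
            unfolding norm_mult using elim z by (intro mult_mono) auto
          then show ?thesis using norm_triangle_ineq2[of 1 "cnj (a k) * z"] by simp
        qed
        then have "(1 - norm (a k))\<^sup>2 \<le> (norm (1 - cnj (a k) * z))\<^sup>2"
          using norm_zero_less_1[of k] by (intro power_mono) auto
        moreover have "(1 - r\<^sup>2) * (1 - (norm (a k))\<^sup>2) \<le> (1 - r\<^sup>2) * 1"
          using elim by (intro mult_left_mono) (auto simp: power_le_one)
        ultimately show ?thesis
          unfolding blaschke_defect_def z using norm_zero_less_1[of k] elim
          by (intro frac_le) (auto simp: power_le_one)
      qed
      have "e < 1 - (\<Sum>k<M. blaschke_defect (a k) z)"
        using elim sum_mono[of "{..<M}" "\<lambda>k. blaschke_defect (a k) z", OF le] by linarith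
      also have "\<dots> \<le> (\<Prod>k<M. 1 - blaschke_defect (a k) z)"
        using elim z norm_zero_less_1
        by (intro Weierstrass_prod_ineq) (auto intro!: blaschke_defect_nonneg blaschke_defect_le_1)
      also have "\<dots> = (norm (\<Prod>k<M. blaschke_factor (a k) z))\<^sup>2"
        using elim z norm_zero_less_1
        by (simp add: prod_norm[symmetric] prod_power_distrib norm_blaschke_factor_squared)
      finally show "e < (norm (\<Prod>k<M. blaschke_factor (a k) z))\<^sup>2" .
    qed
  qed
qed

end

section \<open>Unrestricted limits have modulus one\<close>

lemma at_within_ball_nontrivial:
  assumes "norm (\<zeta>::complex) = 1"
  shows "at \<zeta> within ball 0 1 \<noteq> bot"
  using assms by (simp add: trivial_limit_within islimpt_ball)

context blaschke_zeros
begin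

text \<open>
  The maximum principle is applied to the product of finitely many rotates of a tail of the
  product: on a circle of radius close to 1, one rotate always falls into the region
  where the tail is bounded away from 1, so its value at 0 could not tend to 1.
\<close>

lemma norm_unrestricted_limit:
  assumes \<zeta>: "norm \<zeta> = 1" and lim: "(prod_at \<longlongrightarrow> L) (at \<zeta> within ball 0 1)"
  shows "norm L = 1"
proof (rule ccontr)
  assume "norm L \<noteq> 1"
  have "eventually (\<lambda>z. norm (prod_at z) \<le> 1) (at \<zeta> within ball 0 1)"
    using norm_prod_at_le_1 by (auto simp: eventually_at_filter)
  then have "norm L \<le> 1"
    using at_within_ball_nontrivial[OF \<zeta>] tendsto_norm[OF lim] by (intro tendsto_upperbound)
  with \<open>norm L \<noteq> 1\<close> have L: "norm L < 1" by simp
  define c where "c = (1 + norm L) / 2"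
  \<comment> \<open>Near \<zeta> the whole product is below \<open>c\<close>. Where the finite part
    exceeds \<open>c / c'\<close>, the tail is therefore at most \<open>c'\<close>.\<close>
  define c' where "c' = (1 + c) / 2"
  have c: "norm L < c" "0 < c" "c < c'" "c' < 1" "0 < c'"
    using L by (auto simp: c_def c'_def field_simps intro: add_pos_nonneg add_nonneg_pos)
  have "eventually (\<lambda>z. norm (prod_at z) < c) (at \<zeta> within ball 0 1)"
    using tendsto_norm[OF lim] c(1) by (rule order_tendstoD)
  then obtain d0 where d0: "d0 > 0" "\<And>z. norm z < 1 \<Longrightarrow> norm (z - \<zeta>) < d0 \<Longrightarrow> norm (prod_at z) < c"
    using \<zeta> unfolding eventually_at dist_norm by (metis less_irrefl mem_ball_0)
  define d where "d = min d0 1"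
  have d: "d > 0" "d \<le> 1" "\<And>z. norm z < 1 \<Longrightarrow> norm (z - \<zeta>) < d \<Longrightarrow> norm (prod_at z) < c"
    using d0 by (auto simp: d_def)
  \<comment> \<open>Rotations by the \<open>m\<close>-th roots of unity bring each point of the
    circle within \<open>d / 2\<close> of \<zeta>. It matters that \<open>m\<close> does not depend
    on \<open>M\<close>: the \<open>m\<close>-th powers of the tails at 0 then still tend to
    1.\<close>
  obtain m :: nat where m: "real m > 14 / d" using reals_Archimedean2 by blast
  have md: "7 \<le> real m * (d / 2)" using m d by (simp add: field_simps)
  have bound: "norm (blaschke_zeros.prod_at (\<lambda>n. a (n + M)) 0) ^ m \<le> c'" for M
  proof -
    interpret T: blaschke_zeros "\<lambda>n. a (n + M)" by (rule tail)
    have "(c / c')\<^sup>2 < 1" using c by (simp add: power_less_one_iff)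
    then have "eventually (\<lambda>r. \<forall>z. norm z = r \<longrightarrow>
        (c / c')\<^sup>2 < (norm (\<Prod>k<M. blaschke_factor (a k) z))\<^sup>2) (at_left 1)"
      by (rule norm_partial_prod_near_1)
    moreover have "eventually (\<lambda>r::real. r \<in> {1 - d / 2<..<1}) (at_left 1)"
      by (rule eventually_at_left_real) (use d in simp)
    ultimately have "eventually (\<lambda>r::real. r \<in> {1 - d / 2<..<1} \<and> (\<forall>z. norm z = r \<longrightarrow>
        (c / c')\<^sup>2 < (norm (\<Prod>k<M. blaschke_factor (a k) z))\<^sup>2)) (at_left 1)"
      by eventually_elim auto
    from eventually_happens'[OF trivial_limit_at_left_real this]
    obtain r where r: "1 - d / 2 < r" "r < 1"
      and fin: "\<And>z. norm z = r \<Longrightarrow> (c / c')\<^sup>2 < (norm (\<Prod>k<M. blaschke_factor (a k) z))\<^sup>2"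
      by auto
    have r0: "r > 0" using r d by simp
    \<comment> \<open>At each point of modulus \<open>r\<close> one rotated factor is at most
      \<open>c'\<close> and the others are at most 1, whereas at 0 all \<open>m\<close> factors
      coincide.\<close>
    define g where "g = (\<lambda>z. \<Prod>q<m. T.prod_at (mesh_point m q * z))"
    have holg: "g holomorphic_on ball 0 1"
    proof -
      have "(T.prod_at \<circ> (\<lambda>z. mesh_point m q * z)) holomorphic_on ball 0 1" for q
        by (intro holomorphic_on_compose_gen[OF _ T.holomorphic_prod_at] holomorphic_intros)
           (auto simp: norm_mult)
      then show ?thesis unfolding g_def by (intro holomorphic_on_prod) (simp add: o_def)
    qed
    have "norm (g 0) \<le> c'"
    proof (rule maximum_modulus_frontier[of g "cball 0 r"])
      show "g holomorphic_on interior (cball 0 r)"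
        using r by (intro holomorphic_on_subset[OF holg]) (auto simp: interior_cball)
      show "continuous_on (closure (cball 0 r)) g"
        using r by (intro holomorphic_on_imp_continuous_on holomorphic_on_subset[OF holg]) auto
      show "norm (g z) \<le> c'" if "z \<in> frontier (cball 0 r)" for z
      proof -
        have z: "norm z = r" using that by (simp add: frontier_cball)
        have zr: "z / r \<noteq> 0" "norm (z / r) = 1" using z r0 by (auto simp: norm_divide)
        obtain q where q: "q < m" "norm (mesh_point m q * (z / r) - \<zeta>) \<le> d / 2"
          using mesh_rotation_near[OF zr(2) \<zeta> _ _ md] d by auto
        define w where "w = mesh_point m q * z"
        have w: "norm w = r" using z by (simp add: w_def norm_mult)
        have "w - mesh_point m q * (z / r) = of_real (r - 1) * (mesh_point m q * (z / r))"
          using r0 by (simp add: w_def field_simps)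
        then have "norm (w - mesh_point m q * (z / r)) = \<bar>r - 1\<bar>"
          using zr(2) by (simp only: norm_mult norm_of_real norm_mesh_point mult_1_right)
        then have "norm (w - mesh_point m q * (z / r)) < d / 2" using r by simp
        then have "norm (w - \<zeta>) < d"
          using q(2) norm_triangle_ineq[of "w - mesh_point m q * (z / r)" "mesh_point m q * (z / r) - \<zeta>"]
          by simp
        then have lt: "norm (prod_at w) < c" using d(3)[of w] w r by simp
        have "c / c' < norm (\<Prod>k<M. blaschke_factor (a k) w)"
          using fin[OF w] by (rule power_less_imp_less_base) simp
        then have "c / c' * norm (T.prod_at w) \<le> norm (prod_at w)"
          unfolding prod_at_split[of w M, unfolded w, OF r(2)] norm_mult by (intro mult_right_mono) auto
        then have "c / c' * norm (T.prod_at w) \<le> c" using lt by simp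
        then have Tw: "norm (T.prod_at w) \<le> c'" using c by (simp add: field_simps)
        have "norm (g z) = norm (T.prod_at w) * (\<Prod>i\<in>{..<m} - {q}. norm (T.prod_at (mesh_point m i * z)))"
          unfolding g_def w_def prod_norm[symmetric] using q(1) by (intro prod.remove) auto
        also have "\<dots> \<le> norm (T.prod_at w) * 1"
          using z r by (intro mult_left_mono prod_le_1) (auto simp: norm_mult intro!: T.norm_prod_at_le_1)
        finally show ?thesis using Tw by simp
      qed
    qed (use r0 in auto)
    then show ?thesis by (simp add: g_def norm_power)
  qed
  have lim0: "(\<lambda>M. 1 - (\<Sum>n. 1 - norm (a (n + M)))) \<longlonglongrightarrow> 1 - 0"
    by (intro tendsto_diff tendsto_const suminf_exist_split2[OF summable_zeros])
  have "(\<lambda>M. norm (blaschke_zeros.prod_at (\<lambda>n. a (n + M)) 0)) \<longlonglongrightarrow> 1"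
  proof (rule tendsto_sandwich)
    show "eventually (\<lambda>M. 1 - (\<Sum>n. 1 - norm (a (n + M))) \<le> norm (blaschke_zeros.prod_at (\<lambda>n. a (n + M)) 0)) sequentially"
      using blaschke_zeros.norm_prod_at_0_ge[OF tail] by simp
    show "eventually (\<lambda>M. norm (blaschke_zeros.prod_at (\<lambda>n. a (n + M)) 0) \<le> 1) sequentially"
      using blaschke_zeros.norm_prod_at_le_1[OF tail] by simp
  qed (use lim0 in simp_all)
  then have "(\<lambda>M. norm (blaschke_zeros.prod_at (\<lambda>n. a (n + M)) 0) ^ m) \<longlonglongrightarrow> 1 ^ m"
    by (intro tendsto_power) simp
  then have "1 ^ m \<le> c'"
    using bound by (intro LIMSEQ_le_const2) auto
  with c show False by simp
qed

end

section \<open>Comparing the two kinds of limits; openness of the set of unrestricted limits\<close>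

lemma is_blaschke_product_iff:
  "is_blaschke_product B \<longleftrightarrow>
    (\<exists>a. blaschke_zeros a \<and> (\<forall>z\<in>ball 0 1. B z = blaschke_zeros.prod_at a z))"
  unfolding is_blaschke_product_def
  by (auto simp: blaschke_zeros_def blaschke_zeros.prod_at_def)

lemma has_unrestricted_limit_at_cong:
  assumes "\<And>z. z \<in> ball 0 1 \<Longrightarrow> f z = g z"
  shows "has_unrestricted_limit_at f \<zeta> \<longleftrightarrow> has_unrestricted_limit_at g \<zeta>"
  unfolding has_unrestricted_limit_at_def
  using assms by (intro ex_cong1 Lim_cong_within) auto

lemma has_radial_limit_at_cong:
  assumes "\<And>z. z \<in> ball 0 1 \<Longrightarrow> f z = g z" and \<zeta>: "norm \<zeta> = 1"
  shows "has_radial_limit_at f \<zeta> \<longleftrightarrow> has_radial_limit_at g \<zeta>"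
  unfolding has_radial_limit_at_def
proof (intro ex_cong1 tendsto_cong)
  have "eventually (\<lambda>r::real. r \<in> {0<..<1}) (at_left 1)"
    by (rule eventually_at_left_real) simp
  then show "\<forall>\<^sub>F r in at_left 1. f (complex_of_real r * \<zeta>) = g (complex_of_real r * \<zeta>)"
    by eventually_elim (use assms in \<open>auto simp: norm_mult\<close>)
qed

lemma filterlim_radius:
  assumes \<zeta>: "norm \<zeta> = 1"
  shows "filterlim (\<lambda>r. complex_of_real r * \<zeta>) (at \<zeta> within ball 0 1) (at_left 1)"
  unfolding filterlim_at
proof
  have "((\<lambda>r. complex_of_real r * \<zeta>) \<longlongrightarrow> complex_of_real 1 * \<zeta>) (at_left 1)"
    by (intro tendsto_intros)
  then show "((\<lambda>r. complex_of_real r * \<zeta>) \<longlongrightarrow> \<zeta>) (at_left 1)" by simp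
  have "eventually (\<lambda>r::real. r \<in> {0<..<1}) (at_left 1)"
    by (rule eventually_at_left_real) simp
  then show "\<forall>\<^sub>F r in at_left 1. complex_of_real r * \<zeta> \<in> ball 0 1 \<and> complex_of_real r * \<zeta> \<noteq> \<zeta>"
    by eventually_elim (use \<zeta> in \<open>auto simp: norm_mult\<close>)
qed

lemma unrestricted_limit_imp_radial_limit:
  assumes "norm \<zeta> = 1" "(f \<longlongrightarrow> L) (at \<zeta> within ball 0 1)"
  shows "((\<lambda>r. f (complex_of_real r * \<zeta>)) \<longlongrightarrow> L) (at_left 1)"
  using filterlim_compose[OF assms(2) filterlim_radius[OF assms(1)]] .

lemma has_unrestricted_imp_has_radial_limit:
  assumes "norm \<zeta> = 1" "has_unrestricted_limit_at f \<zeta>"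
  shows "has_radial_limit_at f \<zeta>"
  using assms unrestricted_limit_imp_radial_limit
  unfolding has_unrestricted_limit_at_def has_radial_limit_at_def by blast

text \<open>The limit has modulus 1 and so is not 0, which keeps the zeros at distance
  \<open>d\<close> from \<zeta>. Boundary points within \<open>d / 2\<close> of \<zeta> are then
  still at distance \<open>d / 2\<close> from all zeros.\<close>

lemma (in blaschke_zeros) unrestricted_limit_set_open:
  assumes \<zeta>: "norm \<zeta> = 1" and lim: "has_unrestricted_limit_at prod_at \<zeta>"
  obtains d where "d > 0"
    "\<And>\<xi>. norm \<xi> = 1 \<Longrightarrow> norm (\<xi> - \<zeta>) < d \<Longrightarrow> has_unrestricted_limit_at prod_at \<xi>"
proof -
  obtain L where L: "(prod_at \<longlongrightarrow> L) (at \<zeta> within ball 0 1)"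
    using lim by (auto simp: has_unrestricted_limit_at_def)
  have "L \<noteq> 0" using norm_unrestricted_limit[OF \<zeta> L] by auto
  then have "eventually (\<lambda>z. prod_at z \<noteq> 0) (at \<zeta> within ball 0 1)"
    using L by (intro tendsto_imp_eventually_ne)
  then obtain d where d: "d > 0" "\<And>z. norm z < 1 \<Longrightarrow> norm (z - \<zeta>) < d \<Longrightarrow> prod_at z \<noteq> 0"
    using \<zeta> unfolding eventually_at dist_norm by (metis less_irrefl mem_ball_0)
  have far: "d \<le> norm (a n - \<zeta>)" for n
    using d(2)[of "a n"] norm_zero_less_1[of n] prod_at_zero[of n] by force
  have "has_unrestricted_limit_at prod_at \<xi>" if "norm \<xi> = 1" "norm (\<xi> - \<zeta>) < d / 2" for \<xi>
  proof (rule unrestricted_limit_if_zeros_far[OF that(1)])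
    show "d / 2 > 0" using d by simp
    show "d / 2 \<le> norm (a n - \<xi>)" for n
      using far[of n] that(2) norm_triangle_ineq[of "a n - \<xi>" "\<xi> - \<zeta>"] by simp
  qed
  with that[of "d / 2"] d show thesis by simp
qed

lemma (in blaschke_zeros) closed_no_unrestricted_limit:
  "closed {\<zeta> \<in> sphere 0 1. \<not> has_unrestricted_limit_at prod_at \<zeta>}"
proof -
  have "openin (top_of_set (sphere 0 1)) {\<zeta> \<in> sphere 0 1. has_unrestricted_limit_at prod_at \<zeta>}"
    unfolding openin_euclidean_subtopology_iff
  proof (intro conjI ballI)
    fix \<zeta> assume "\<zeta> \<in> {\<zeta> \<in> sphere 0 1. has_unrestricted_limit_at prod_at \<zeta>}"
    then have "norm \<zeta> = 1" "has_unrestricted_limit_at prod_at \<zeta>" by auto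
    then obtain d where "d > 0"
      "\<And>\<xi>. norm \<xi> = 1 \<Longrightarrow> norm (\<xi> - \<zeta>) < d \<Longrightarrow> has_unrestricted_limit_at prod_at \<xi>"
      using unrestricted_limit_set_open by metis
    then show "\<exists>e>0. \<forall>x'\<in>sphere 0 1. dist x' \<zeta> < e \<longrightarrow> x' \<in> {\<zeta> \<in> sphere 0 1. has_unrestricted_limit_at prod_at \<zeta>}"
      by (auto simp: dist_norm)
  qed auto
  then have "closedin (top_of_set (sphere 0 1))
      (sphere 0 1 - {\<zeta> \<in> sphere 0 1. has_unrestricted_limit_at prod_at \<zeta>})"
    using closedin_diff[OF closedin_topspace, of "top_of_set (sphere 0 1)"] by simp
  then have "closed (sphere 0 1 - {\<zeta> \<in> sphere 0 1. has_unrestricted_limit_at prod_at \<zeta>})"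
    using closed_sphere closedin_closed_trans by blast
  moreover have "sphere 0 1 - {\<zeta> \<in> sphere 0 1. has_unrestricted_limit_at prod_at \<zeta>}
      = {\<zeta> \<in> sphere 0 1. \<not> has_unrestricted_limit_at prod_at \<zeta>}" by auto
  ultimately show ?thesis by simp
qed

section \<open>Sets of type G-delta-sigma\<close>

text \<open>Only the quantifiers over \<open>n\<close> and \<open>m\<close> turn into set operations
  that have to be countable. The inequality is not strict, so that its negation is an open condition
  on \<zeta> for continuous \<open>f\<close>.\<close>

lemma radial_limit_iff_Cauchy:
  "has_radial_limit_at f \<zeta> \<longleftrightarrow>
    (\<forall>n::nat. \<exists>m::nat. \<forall>s\<in>{1 - 1 / Suc m<..<1}. \<forall>t\<in>{1 - 1 / Suc m<..<1}.
      dist (f (of_real s * \<zeta>)) (f (of_real t * \<zeta>)) \<le> 1 / Suc n)"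
  (is "_ \<longleftrightarrow> ?R")
proof
  assume "has_radial_limit_at f \<zeta>"
  then obtain L where L: "((\<lambda>r. f (of_real r * \<zeta>)) \<longlongrightarrow> L) (at_left 1)"
    by (auto simp: has_radial_limit_at_def)
  show ?R
  proof
    fix n :: nat
    have "eventually (\<lambda>r. dist (f (of_real r * \<zeta>)) L < 1 / (2 * Suc n)) (at_left 1)"
      by (rule tendstoD[OF L]) simp
    then obtain b where b: "b < 1" "\<And>r. b < r \<Longrightarrow> r < 1 \<Longrightarrow> dist (f (of_real r * \<zeta>)) L < 1 / (2 * Suc n)"
      by (auto simp: eventually_at_left_field)
    obtain m where m: "1 / real (Suc m) < 1 - b"
      using nat_approx_posE[of "1 - b"] b by auto
    show "\<exists>m::nat. \<forall>s\<in>{1 - 1 / Suc m<..<1}. \<forall>t\<in>{1 - 1 / Suc m<..<1}.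
      dist (f (of_real s * \<zeta>)) (f (of_real t * \<zeta>)) \<le> 1 / Suc n"
    proof (intro exI[of _ m] ballI)
      fix s t assume "s \<in> {1 - 1 / real (Suc m)<..<1}" "t \<in> {1 - 1 / real (Suc m)<..<1}"
      then have "dist (f (of_real s * \<zeta>)) L < 1 / (2 * Suc n)" "dist (f (of_real t * \<zeta>)) L < 1 / (2 * Suc n)"
        using m unfolding greaterThanLessThan_iff by (intro b(2); linarith)+
      then have "dist (f (of_real s * \<zeta>)) L < (1 / Suc n) / 2" "dist (f (of_real t * \<zeta>)) L < (1 / Suc n) / 2"
        by (simp_all add: field_simps)
      then have "dist (f (of_real s * \<zeta>)) (f (of_real t * \<zeta>)) < 1 / Suc n"
        by (rule dist_triangle_half_l)
      then show "dist (f (of_real s * \<zeta>)) (f (of_real t * \<zeta>)) \<le> 1 / Suc n" by simp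
    qed
  qed
next
  assume R: ?R
  define x where "x k = f (of_real (1 - 1 / real (Suc (Suc k))) * \<zeta>)" for k
  have rad: "1 - 1 / real (Suc (Suc k)) \<in> {1 - 1 / real (Suc m)<..<1}" if "k \<ge> m" for k m
    using that by (auto simp: field_simps)
  have "Cauchy x"
  proof (rule metric_CauchyI)
    fix e :: real assume "e > 0"
    then obtain n where n: "1 / real (Suc n) < e" using nat_approx_posE by blast
    obtain m where "\<forall>s\<in>{1 - 1 / Suc m<..<1}. \<forall>t\<in>{1 - 1 / Suc m<..<1}.
      dist (f (of_real s * \<zeta>)) (f (of_real t * \<zeta>)) \<le> 1 / Suc n" using R by blast
    then have "dist (x k) (x l) \<le> 1 / Suc n" if "k \<ge> m" "l \<ge> m" for k l
      using rad that unfolding x_def by blast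
    then show "\<exists>M. \<forall>k\<ge>M. \<forall>l\<ge>M. dist (x k) (x l) < e"
      using n by (meson le_less_trans)
  qed
  then obtain L where L: "x \<longlonglongrightarrow> L" using Cauchy_convergent convergent_def by blast
  have "((\<lambda>r. f (of_real r * \<zeta>)) \<longlongrightarrow> L) (at_left 1)"
  proof (rule tendstoI)
    fix e :: real assume "e > 0"
    then obtain n where n: "1 / real (Suc n) < e" using nat_approx_posE by blast
    obtain m :: nat where m: "\<forall>s\<in>{1 - 1 / Suc m<..<1}. \<forall>t\<in>{1 - 1 / Suc m<..<1}.
      dist (f (of_real s * \<zeta>)) (f (of_real t * \<zeta>)) \<le> 1 / Suc n" using R by blast
    have "dist (f (of_real s * \<zeta>)) L \<le> 1 / Suc n" if "s \<in> {1 - 1 / real (Suc m)<..<1}" for s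
    proof (rule LIMSEQ_le_const2)
      show "(\<lambda>k. dist (f (of_real s * \<zeta>)) (x k)) \<longlonglongrightarrow> dist (f (of_real s * \<zeta>)) L"
        by (intro tendsto_intros L)
      show "\<exists>N. \<forall>k\<ge>N. dist (f (of_real s * \<zeta>)) (x k) \<le> 1 / Suc n"
        using m that rad unfolding x_def by blast
    qed
    then have "dist (f (of_real s * \<zeta>)) L < e" if "1 - 1 / real (Suc m) < s" "s < 1" for s
      using n that by force
    then show "eventually (\<lambda>s. dist (f (of_real s * \<zeta>)) L < e) (at_left 1)"
      unfolding eventually_at_left_field by (intro exI[of _ "1 - 1 / real (Suc m)"]) auto
  qed
  then show "has_radial_limit_at f \<zeta>" by (auto simp: has_radial_limit_at_def)
qed

lemma gdelta_sigma_in_UN_INT: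
  assumes "\<And>i n. openin X (U i n)"
  shows "gdelta_sigma_in X (\<Union>i::nat. \<Inter>n::nat. U i n)"
proof -
  have "gdelta_in X (\<Inter>n. U i n)" for i
    using assms by (intro gdelta_in_Inter) (auto intro: open_imp_gdelta_in)
  then show ?thesis
    unfolding gdelta_sigma_in_def union_of_def
    by (intro exI[of _ "range (\<lambda>i. \<Inter>n. U i n)"]) auto
qed

text \<open>Negating the Cauchy criterion gives a union over \<open>n\<close> of intersections over
  \<open>m\<close>. The remaining existential quantifiers over \<open>s\<close> and \<open>t\<close>
  are uncountable unions of open sets, hence open.\<close>

lemma gdelta_sigma_no_radial_limit:
  assumes cont: "continuous_on (ball 0 1) f"
  shows "gdelta_sigma_in (top_of_set (sphere 0 1)) {\<zeta> \<in> sphere 0 1. \<not> has_radial_limit_at f \<zeta>}"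
proof -
  define I where "I m = {1 - 1 / real (Suc m)<..<1}" for m
  define U where "U n m = {\<zeta> \<in> sphere 0 1. \<exists>s\<in>I m. \<exists>t\<in>I m.
      1 / real (Suc n) < dist (f (of_real s * \<zeta>)) (f (of_real t * \<zeta>))}" for n m
  have "openin (top_of_set (sphere 0 1)) (U n m)" for n m
  proof -
    have "openin (top_of_set (sphere 0 1))
        (sphere 0 1 \<inter> (\<lambda>\<zeta>. dist (f (of_real s * \<zeta>)) (f (of_real t * \<zeta>))) -` {1 / real (Suc n)<..})"
      if "s \<in> I m" "t \<in> I m" for s t
    proof (rule continuous_openin_preimage_gen)
      have "1 / real (Suc m) \<le> 1" by simp
      then have st: "0 < s" "s < 1" "0 < t" "t < 1" using that unfolding I_def greaterThanLessThan_iff by linarith+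
      have "continuous_on (sphere 0 1) (\<lambda>\<zeta>. f (of_real r * \<zeta>))" if "0 < r" "r < 1" for r
        using that by (intro continuous_on_compose2[OF cont]) (auto intro!: continuous_intros simp: norm_mult)
      then show "continuous_on (sphere 0 1) (\<lambda>\<zeta>. dist (f (of_real s * \<zeta>)) (f (of_real t * \<zeta>)))"
        using st by (intro continuous_on_dist)
    qed simp
    note op = this
    have eq: "U n m = (\<Union>s\<in>I m. \<Union>t\<in>I m.
        sphere 0 1 \<inter> (\<lambda>\<zeta>. dist (f (of_real s * \<zeta>)) (f (of_real t * \<zeta>))) -` {1 / real (Suc n)<..})"
      by (auto simp: U_def)
    show ?thesis
      unfolding eq
      by (rule openin_Union, erule imageE, hypsubst, rule openin_Union, erule imageE, hypsubst, rule op)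
  qed
  then have "gdelta_sigma_in (top_of_set (sphere 0 1)) (\<Union>n. \<Inter>m. U n m)"
    by (rule gdelta_sigma_in_UN_INT)
  moreover have "(\<Union>n. \<Inter>m. U n m) = {\<zeta> \<in> sphere 0 1. \<not> has_radial_limit_at f \<zeta>}"
  proof (rule set_eqI)
    fix \<zeta> :: complex
    have "\<not> has_radial_limit_at f \<zeta> \<longleftrightarrow> (\<exists>n. \<forall>m. \<exists>s\<in>I m. \<exists>t\<in>I m.
        1 / real (Suc n) < dist (f (of_real s * \<zeta>)) (f (of_real t * \<zeta>)))"
      unfolding radial_limit_iff_Cauchy I_def not_le[symmetric] by blast
    then show "\<zeta> \<in> (\<Union>n. \<Inter>m. U n m) \<longleftrightarrow> \<zeta> \<in> {\<zeta> \<in> sphere 0 1. \<not> has_radial_limit_at f \<zeta>}"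
      unfolding U_def UN_iff INT_iff mem_Collect_eq by blast
  qed
  ultimately show ?thesis by simp
qed

lemma gdelta_in_subtopologyE:
  assumes "gdelta_in (top_of_set T) S"
  obtains U :: "nat \<Rightarrow> 'a::topological_space set" where "\<And>n. open (U n)" "S = T \<inter> (\<Inter>n. U n)"
proof -
  from assms have ST: "S \<subseteq> T" and "(countable intersection_of openin (top_of_set T)) S"
    by (auto simp: gdelta_in_alt)
  then obtain \<V> where V: "countable \<V>" "\<And>V. V \<in> \<V> \<Longrightarrow> openin (top_of_set T) V" "\<Inter>\<V> = S"
    by (auto simp: intersection_of_def)
  have "\<exists>W. open W \<and> V = T \<inter> W" if "V \<in> \<V>" for V
    using V(2)[OF that] by (auto simp: openin_open)
  then obtain W where W: "\<And>V. V \<in> \<V> \<Longrightarrow> open (W V)" "\<And>V. V \<in> \<V> \<Longrightarrow> V = T \<inter> W V"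
    by metis
  \<comment> \<open>The extra \<open>UNIV\<close> leaves the intersection unchanged and makes the
    family nonempty, as an enumeration by \<open>from_nat_into\<close> requires.\<close>
  let ?F = "insert UNIV (W ` \<V>)"
  have rng: "range (from_nat_into ?F) = ?F"
    using V(1) by (intro range_from_nat_into) auto
  have "open (from_nat_into ?F n)" for n
    using from_nat_into[of ?F n] W(1) by fastforce
  moreover have "S = T \<inter> (\<Inter>n. from_nat_into ?F n)"
    unfolding rng using V(3) W(2) ST by fastforce
  ultimately show thesis using that by blast
qed

lemma gdelta_sigma_in_subtopologyE:
  assumes "gdelta_sigma_in (top_of_set T) S"
  obtains U :: "nat \<Rightarrow> nat \<Rightarrow> 'a::topological_space set"
    where "\<And>i n. open (U i n)" "S = T \<inter> (\<Union>i. \<Inter>n. U i n)"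
proof -
  obtain \<G> where G: "countable \<G>" "\<And>G. G \<in> \<G> \<Longrightarrow> gdelta_in (top_of_set T) G" "\<Union>\<G> = S"
    using assms by (auto simp: gdelta_sigma_in_def union_of_def)
  let ?F = "insert {} \<G>"
  have rng: "range (from_nat_into ?F) = ?F"
    using G(1) by (intro range_from_nat_into) auto
  have "gdelta_in (top_of_set T) (from_nat_into ?F i)" for i
    using from_nat_into[of ?F i] G(2) by auto
  then have "\<exists>U :: nat \<Rightarrow> 'a set. (\<forall>n. open (U n)) \<and> from_nat_into ?F i = T \<inter> (\<Inter>n. U n)" for i
    by (metis gdelta_in_subtopologyE)
  then obtain U :: "nat \<Rightarrow> nat \<Rightarrow> 'a set" where
    U: "\<And>i n. open (U i n)" "\<And>i. from_nat_into ?F i = T \<inter> (\<Inter>n. U i n)"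
    by metis
  have "S = (\<Union>i. from_nat_into ?F i)" unfolding rng using G(3) by simp
  then have "S = T \<inter> (\<Union>i. \<Inter>n. U i n)" using U(2) by auto
  with U(1) that show thesis by blast
qed

text \<open>
  If \<open>S\<close> is the union over \<open>i\<close> of the intersections over \<open>n\<close> of open sets \<open>U i n\<close>, decreasing in \<open>n\<close>,
  then the nonempty \<open>F k\<close> with \<open>j k = i\<close> are the shells of points of \<open>U i n\<close> at distance about \<open>1 / m\<close>
  from its complement. The shells are locally finite in \<open>U i n\<close>, so that a point outside
  \<open>S\<close> meets only finitely many of them for each \<open>i\<close>.
\<close>

lemma gdelta_sigma_shells:
  fixes S T :: "'a::euclidean_space set"
  assumes "gdelta_sigma_in (top_of_set T) S" and "bounded T"
  obtains F :: "nat \<Rightarrow> 'a set" and j :: "nat \<Rightarrow> nat" and \<eta> :: "nat \<Rightarrow> real" where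
    "\<And>k. \<eta> k > 0" "\<And>k. j k \<le> k" "infinite {k. F k = {}}"
    "\<And>x. x \<in> S \<Longrightarrow> \<exists>i. infinite {k. j k = i \<and> x \<in> F k}"
    "\<And>x i. x \<in> T - S \<Longrightarrow> finite {k. j k = i \<and> (\<exists>y\<in>F k. dist y x < \<eta> k)}"
proof -
  obtain U0 where U0: "\<And>i n. open (U0 i n)" "S = T \<inter> (\<Union>i::nat. \<Inter>n::nat. U0 i n)"
    using gdelta_sigma_in_subtopologyE[OF assms(1)] by metis
  obtain R where R: "T \<subseteq> ball 0 R" using assms(2) bounded_subset_ballD by blast
  define U where "U i n = ball 0 R \<inter> (\<Inter>l\<le>n. U0 i l)" for i n
  have opU: "open (U i n)" for i n
    unfolding U_def using U0(1) by (intro open_Int open_INT) auto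
  have S: "S = T \<inter> (\<Union>i. \<Inter>n. U i n)"
    unfolding U_def U0(2) using R by fastforce
  have decr: "U i m \<subseteq> U i n" if "n \<le> m" for i m n
    using that by (fastforce simp: U_def)
  have ne: "- U i n \<noteq> {}" for i n
  proof -
    obtain x :: 'a where "norm x = max R 0" using vector_choose_size[of "max R 0"] by auto
    then have "x \<notin> ball 0 R" by auto
    then show ?thesis by (auto simp: U_def)
  qed
  define d where "d i n x = infdist x (- U i n)" for i n x
  have dpos: "d i n x > 0" if "x \<in> U i n" for i n x
  proof -
    have "closed (- U i n)" using opU by auto
    then show ?thesis
      using in_closed_iff_infdist_zero[of "- U i n" x] ne that infdist_nonneg[of x "- U i n"]
      by (simp add: d_def less_le)
  qed
  have d0: "d i n x = 0" if "x \<notin> U i n" for i n x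
    using that by (simp add: d_def)
  \<comment> \<open>On the shell with index \<open>m\<close> the distance to the complement exceeds
    \<open>1 / (m + 1)\<close> and, for \<open>m > 0\<close>, is at most
    \<open>1 / m\<close>.\<close>
  define shell where "shell i n m = {x \<in> U i n. nat \<lfloor>1 / d i n x\<rfloor> = m}" for i n m
  have shell_lower: "1 / Suc m < d i n x" if "x \<in> shell i n m" for i n m x
  proof -
    have p: "d i n x > 0" using that dpos by (auto simp: shell_def)
    have "1 / d i n x < real m + 1"
      using that p unfolding shell_def by (auto simp: floor_less_iff nat_eq_iff2 intro!: le_nat_floor) linarith
    then show ?thesis using p by (simp add: field_simps)
  qed
  have shell_upper: "real m * d i n x \<le> 1" if "x \<in> shell i n m" for i n m x
  proof -
    have p: "d i n x > 0" using that dpos by (auto simp: shell_def)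
    then have "real m \<le> 1 / d i n x"
      using that unfolding shell_def by (auto simp: of_nat_floor)
    then show ?thesis using p by (simp add: field_simps)
  qed
  have lip: "\<bar>d i n x - d i n y\<bar> \<le> dist x y" for i n x y
    unfolding d_def using infdist_triangle_abs[of x "- U i n" y] by simp
  \<comment> \<open>An index \<open>k\<close> codes a flag together with \<open>i\<close>,
    \<open>n\<close> and \<open>m\<close>. Nonzero flags give the infinitely many empty sets, and a
    decoded component never exceeds its code, whence \<open>j k \<le> k\<close>.\<close>
  define b where "b k = fst (prod_decode k)" for k
  define j where "j k = fst (prod_decode (snd (prod_decode k)))" for k
  define p where "p k = prod_decode (snd (prod_decode (snd (prod_decode k))))" for k
  define F where "F k = (if b k = 0 then shell (j k) (fst (p k)) (snd (p k)) else {})" for k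
  define \<eta> where "\<eta> k = 1 / real (Suc (snd (p k)))" for k
  define code where "code i n m = prod_encode (0, prod_encode (i, prod_encode (n, m)))" for i n m
  have code: "b (code i n m) = 0" "j (code i n m) = i" "p (code i n m) = (n, m)" for i n m
    by (simp_all add: b_def j_def p_def code_def)
  have code_surj: "k = code (j k) (fst (p k)) (snd (p k))" if "b k = 0" for k
    using that by (simp add: b_def j_def p_def code_def) (metis prod.collapse prod_decode_inverse)
  have near: "x \<in> U i n \<and> real m * d i n x \<le> 2" if y: "y \<in> shell i n m" "dist y x < 1 / Suc m" for i n m x y
  proof
    have "d i n x > 0" using shell_lower[OF y(1)] lip[of i n y x] y(2) by linarith
    then show "x \<in> U i n" using d0[of x i n] by fastforce
    have "real m * d i n x \<le> real m * (d i n y + 1 / Suc m)"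
      using lip[of i n y x] y(2) by (intro mult_left_mono) auto
    also have "\<dots> = real m * d i n y + real m / Suc m" by (simp add: distrib_left)
    also have "\<dots> \<le> 1 + 1" using shell_upper[OF y(1)] by (intro add_mono) auto
    finally show "real m * d i n x \<le> 2" by simp
  qed
  show thesis
  proof
    show "\<eta> k > 0" for k by (simp add: \<eta>_def)
    show "j k \<le> k" for k
      unfolding j_def by (metis le_prod_encode_1 le_prod_encode_2 le_trans prod.collapse prod_decode_inverse)
    show "infinite {k. F k = {}}"
    proof
      assume fin: "finite {k. F k = {}}"
      have "inj (\<lambda>l. prod_encode (Suc 0, l))" by (auto intro!: injI)
      moreover have "range (\<lambda>l. prod_encode (Suc 0, l)) \<subseteq> {k. F k = {}}"
        by (auto simp: F_def b_def)
      ultimately show False using fin by (meson finite_imageD finite_subset infinite_UNIV_nat)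
    qed
    show "\<exists>i. infinite {k. j k = i \<and> x \<in> F k}" if x: "x \<in> S" for x
    proof -
      obtain i where i: "\<And>n. x \<in> U i n" using x S by auto
      define m where "m n = nat \<lfloor>1 / d i n x\<rfloor>" for n
      have "inj (\<lambda>n. code i n (m n))" by (auto intro!: injI simp: code_def)
      moreover have "range (\<lambda>n. code i n (m n)) \<subseteq> {k. j k = i \<and> x \<in> F k}"
        using i by (auto simp: F_def code shell_def m_def)
      ultimately have "infinite {k. j k = i \<and> x \<in> F k}"
        by (meson finite_imageD finite_subset infinite_UNIV_nat)
      then show ?thesis by blast
    qed
    show "finite {k. j k = i \<and> (\<exists>y\<in>F k. dist y x < \<eta> k)}" if x: "x \<in> T - S" for x i
    proof -
      obtain n0 where n0: "x \<notin> U i n0" using x S by auto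
      define M where "M n = nat \<lceil>2 / d i n x\<rceil>" for n
      \<comment> \<open>By \<open>near\<close>, \<open>x\<close> itself lies in
        \<open>U i n\<close>, which bounds \<open>n\<close> because these sets decrease and
        \<open>x\<close> misses \<open>U i n0\<close>; its distance to the complement then bounds
        \<open>m\<close>.\<close>
      have "{k. j k = i \<and> (\<exists>y\<in>F k. dist y x < \<eta> k)} \<subseteq> (\<Union>n<n0. \<Union>m\<le>M n. {code i n m})"
      proof
        fix k assume "k \<in> {k. j k = i \<and> (\<exists>y\<in>F k. dist y x < \<eta> k)}"
        then obtain y where k: "j k = i" "y \<in> F k" "dist y x < \<eta> k" by auto
        define n m where "n = fst (p k)" and "m = snd (p k)"
        have b: "b k = 0" and y: "y \<in> shell i n m"
          using k by (auto simp: F_def n_def m_def split: if_splits)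
        have kc: "k = code i n m" using code_surj[OF b] k(1) by (simp add: n_def m_def)
        have xU: "x \<in> U i n" and le: "real m * d i n x \<le> 2"
          using near[OF y, of x] k(3) by (auto simp: \<eta>_def m_def)
        have "n < n0" using decr[of n0 n i] xU n0 by (meson in_mono not_le)
        moreover have "m \<le> M n"
        proof -
          have "real m \<le> 2 / d i n x" using le dpos[OF xU] by (simp add: le_divide_eq)
          also have "\<dots> \<le> real (M n)" unfolding M_def by (rule real_nat_ceiling_ge)
          finally show ?thesis by simp
        qed
        ultimately show "k \<in> (\<Union>n<n0. \<Union>m\<le>M n. {code i n m})" using kc by auto
      qed
      then show ?thesis by (rule finite_subset) auto
    qed
  qed
qed

section \<open>Meshes on the circle\<close>

lemma cis_measurable: "cis \<in> measurable (restrict_space lborel {0..<2 * pi}) (restrict_space borel (sphere 0 1))"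
proof (rule measurable_restrict_space3)
  show "cis \<in> borel_measurable lborel"
    by (simp add: borel_measurable_continuous_onI continuous_on_cis)
qed auto

text \<open>A closed \<open>K\<close> is measurable before completion, so its arc length is the
  Lebesgue measure of its set of angles.\<close>

lemma null_arc_length_closed:
  assumes "closed K" "K \<subseteq> sphere 0 1" "K \<in> null_sets arc_length"
  shows "emeasure lborel (cis -` K \<inter> {0..<2 * pi}) = 0"
proof -
  let ?R = "restrict_space lborel {0..<2 * pi}"
  let ?D = "distr ?R (restrict_space borel (sphere 0 1)) cis"
  have KD: "K \<in> sets ?D"
    using assms by (auto simp: sets_restrict_space intro!: image_eqI[of _ _ K])
  have "emeasure (completion ?D) K = 0"
    using assms(3) by (auto simp: arc_length_def)
  then have "emeasure ?D K = 0" using KD by simp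
  then have "emeasure ?R (cis -` K \<inter> space ?R) = 0"
    using KD by (subst (asm) emeasure_distr[OF cis_measurable]) auto
  then show ?thesis
    by (subst (asm) emeasure_restrict_space) (auto simp: space_restrict_space Int_commute)
qed

text \<open>The closed neighbourhoods of \<open>K\<close> shrink to \<open>K\<close>, so some
  neighbourhood has measure below \<open>e\<close>. Disjoint arcs of length
  \<open>2 * pi / N\<close> starting at the mesh points near \<open>K\<close> fit into it, which
  limits their number. Note that \<open>d\<close> is fixed before \<open>N\<close>.\<close>

lemma card_mesh_near_null_set:
  assumes K: "closed K" "K \<subseteq> sphere 0 1" "K \<noteq> {}" and null: "K \<in> null_sets arc_length" and e: "e > 0"
  obtains d where "d > 0"
    "eventually (\<lambda>N. real (card {q. q < N \<and> infdist (mesh_point N q) K \<le> d}) \<le> e * real N) sequentially"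
proof -
  define A where "A d = {x \<in> {0..<2 * pi}. infdist (cis x) K \<le> d}" for d :: real
  have contd: "continuous_on UNIV (\<lambda>x. infdist (cis x) K)"
    by (intro continuous_intros)
  have A: "A d \<in> sets lborel" for d
  proof -
    have "closed {x. infdist (cis x) K \<le> d}"
      by (intro closed_Collect_le contd continuous_intros)
    moreover have "A d = {0..<2 * pi} \<inter> {x. infdist (cis x) K \<le> d}" by (auto simp: A_def)
    ultimately show ?thesis by (simp add: borel_closed sets.Int)
  qed
  have fin: "emeasure lborel (A d) \<noteq> \<infinity>" for d
  proof -
    have "emeasure lborel (A d) \<le> emeasure lborel {0..<2 * pi}"
      by (rule emeasure_mono) (auto simp: A_def)
    also have "\<dots> < \<infinity>" by simp
    finally show ?thesis by simp
  qed
  have "(\<lambda>n. measure lborel (A (1 / Suc n))) \<longlonglongrightarrow> measure lborel (\<Inter>n. A (1 / real (Suc n)))"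
  proof (rule Lim_measure_decseq)
    show "decseq (\<lambda>n. A (1 / real (Suc n)))"
    proof (rule decseq_SucI)
      show "A (1 / real (Suc (Suc n))) \<le> A (1 / real (Suc n))" for n
      proof -
        have "1 / real (Suc (Suc n)) \<le> 1 / real (Suc n)" by (intro divide_left_mono) auto
        then show ?thesis unfolding A_def by (blast intro: order_trans)
      qed
    qed
  qed (use A fin in auto)
  moreover have "(\<Inter>n. A (1 / real (Suc n))) = cis -` K \<inter> {0..<2 * pi}"
  proof
    show "(\<Inter>n. A (1 / real (Suc n))) \<subseteq> cis -` K \<inter> {0..<2 * pi}"
    proof
      fix x assume x: "x \<in> (\<Inter>n. A (1 / real (Suc n)))"
      then have le: "infdist (cis x) K \<le> 1 / real (Suc n)" for n unfolding A_def by blast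
      have "infdist (cis x) K = 0"
      proof (rule ccontr)
        assume "infdist (cis x) K \<noteq> 0"
        then have "infdist (cis x) K > 0" using infdist_nonneg[of "cis x" K] by linarith
        then obtain n where "1 / real (Suc n) < infdist (cis x) K" using nat_approx_posE by blast
        with le[of n] show False by linarith
      qed
      then show "x \<in> cis -` K \<inter> {0..<2 * pi}"
        using in_closed_iff_infdist_zero[OF K(1,3)] x by (auto simp: A_def)
    qed
  qed (auto simp: A_def)
  ultimately have "(\<lambda>n. measure lborel (A (1 / Suc n))) \<longlonglongrightarrow> 0"
    using null_arc_length_closed[OF K(1,2) null] by (simp add: measure_def)
  then have "eventually (\<lambda>n. measure lborel (A (1 / Suc n)) < e) sequentially"
    using e by (rule order_tendstoD)
  then obtain n where n: "measure lborel (A (1 / Suc n)) < e"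
    using eventually_happens'[OF sequentially_bot] by blast
  \<comment> \<open>Half of the radius just found: arcs of length at most \<open>d\<close> starting
    within \<open>d\<close> of \<open>K\<close> stay within \<open>2 * d\<close>.\<close>
  define d where "d = 1 / (2 * real (Suc n))"
  have d: "d > 0" "2 * d = 1 / Suc n" by (auto simp: d_def field_simps)
  have count: "real (card {q. q < N \<and> infdist (mesh_point N q) K \<le> d}) \<le> e * real N"
    if N: "real N \<ge> 2 * pi / d" for N
  proof -
    have N0: "real N > 0" using N d by (smt (verit, best) divide_pos_pos pi_gt_zero)
    define Q where "Q = {q. q < N \<and> infdist (mesh_point N q) K \<le> d}"
    define J where "J q = {2 * pi * real q / real N ..< 2 * pi * real (Suc q) / real N}" for q
    have fQ: "finite Q" by (simp add: Q_def)
    have mJ: "measure lborel (J q) = 2 * pi / real N" for q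
      using N0 by (simp add: J_def field_simps)
    have sub: "J q \<subseteq> A (2 * d)" if "q \<in> Q" for q
    proof
      fix x assume x: "x \<in> J q"
      have q: "q < N" "infdist (mesh_point N q) K \<le> d" using that by (auto simp: Q_def)
      have "0 \<le> 2 * pi * real q / real N" by simp
      then have "0 \<le> x" using x unfolding J_def atLeastLessThan_iff by linarith
      have "2 * pi * real (Suc q) / real N \<le> 2 * pi * real N / real N"
        using q(1) by (intro divide_right_mono mult_left_mono) auto
      then have "x < 2 * pi" using x N0 unfolding J_def by auto
      have "2 * pi * real (Suc q) / real N = 2 * pi * real q / real N + 2 * pi / real N"
        by (simp add: distrib_left add_divide_distrib)
      then have "\<bar>x - 2 * pi * real q / real N\<bar> \<le> 2 * pi / real N"
        using x unfolding J_def by auto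
      also have "\<dots> \<le> d" using N N0 d by (simp add: field_simps)
      finally have "norm (cis x - mesh_point N q) \<le> d"
        unfolding mesh_point_def using norm_cis_diff_le order_trans by blast
      then have "infdist (cis x) K \<le> 2 * d"
        using infdist_triangle[of "cis x" K "mesh_point N q"] q(2) by (simp add: dist_norm)
      with \<open>0 \<le> x\<close> \<open>x < 2 * pi\<close> show "x \<in> A (2 * d)" by (simp add: A_def)
    qed
    have disj: "disjoint_family_on J Q"
      unfolding disjoint_family_on_def
    proof (intro ballI impI)
      have "J p \<inter> J q = {}" if "p < q" for p q
      proof -
        have "2 * pi * real (Suc p) / real N \<le> 2 * pi * real q / real N"
          using that by (intro divide_right_mono mult_left_mono) auto
        then show ?thesis unfolding J_def by auto
      qed
      then show "J p \<inter> J q = {}" if "p \<noteq> q" for p q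
        using that by (metis Int_commute linorder_neqE_nat)
    qed
    have "real (card Q) * (2 * pi / real N) = (\<Sum>q\<in>Q. measure lborel (J q))"
      by (simp add: mJ)
    also have "\<dots> = measure lborel (\<Union>q\<in>Q. J q)"
    proof (rule measure_finite_Union[symmetric, OF fQ _ disj])
      show "emeasure lborel (J q) \<noteq> \<infinity>" for q
        unfolding J_def by (subst emeasure_lborel_Ico) (auto intro!: divide_right_mono)
    qed (auto simp: J_def)
    also have "\<dots> \<le> measure lborel (A (2 * d))"
    proof (rule measure_mono_fmeasurable)
      show "A (2 * d) \<in> fmeasurable lborel"
        unfolding fmeasurable_def using A[of "2 * d"] fin[of "2 * d"] by (simp add: less_top)
    qed (use sub in \<open>auto simp: J_def intro!: sets.finite_UN fQ\<close>)
    also have "\<dots> < e" using n d by simp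
    finally have "real (card Q) * (2 * pi) \<le> e * real N" using N0 by (simp add: field_simps)
    moreover have "real (card Q) * 1 \<le> real (card Q) * (2 * pi)"
      using pi_gt3 by (intro mult_left_mono) auto
    ultimately show ?thesis by (simp add: Q_def)
  qed
  have "eventually (\<lambda>N::nat. real N \<ge> 2 * pi / d) sequentially"
    using filterlim_real_sequentially by (auto simp: filterlim_at_top)
  then have "eventually (\<lambda>N. real (card {q. q < N \<and> infdist (mesh_point N q) K \<le> d}) \<le> e * real N) sequentially"
    by eventually_elim (rule count)
  with d(1) that show thesis by blast
qed

text \<open>For \<open>c = 1\<close> both sides are monic of degree \<open>N\<close> in
  \<open>z\<close> and vanish at all \<open>N\<close> roots of unity, so their difference has more
  roots than its degree allows unless it is 0. Other nonzero \<open>c\<close> follow by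
  scaling.\<close>

lemma prod_mesh_linear:
  assumes N: "N > 0"
  shows "(\<Prod>q<N. z - c * mesh_point N q) = z ^ N - c ^ N"
proof -
  define P where "P = (\<Prod>q<N. [:- mesh_point N q, 1:]) - (monom 1 N - 1)"
  have mesh_power: "mesh_point N q ^ N = 1" for q
  proof -
    have "mesh_point N q ^ N = cis (2 * pi * real q)"
      using N by (simp add: mesh_point_def Complex.DeMoivre)
    then show ?thesis by (simp add: cis_multiple_2pi)
  qed
  have inj: "inj_on (mesh_point N) {..<N}"
  proof (rule inj_onI)
    fix p q assume pq: "p \<in> {..<N}" "q \<in> {..<N}" "mesh_point N p = mesh_point N q"
    have "(\<lambda>k. cis (2 * pi * real k / real N)) p = (\<lambda>k. cis (2 * pi * real k / real N)) q"
      using pq by (simp add: mesh_point_def)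
    then show "p = q"
      using bij_betw_imp_inj_on[OF Complex.bij_betw_roots_unity[OF N]] pq unfolding inj_on_def by blast
  qed
  have "P = 0"
  proof (rule ccontr)
    assume P0: "P \<noteq> 0"
    have deg: "degree (\<Prod>q<N. [:- mesh_point N q, 1:]) = N"
      by (subst degree_prod_eq_sum_degree) auto
    have lc: "coeff (\<Prod>q<N. [:- mesh_point N q, 1:]) N = 1"
    proof -
      have "lead_coeff (\<Prod>q<N. [:- mesh_point N q, 1:]) = 1"
        by (simp add: lead_coeff_prod)
      then show ?thesis by (simp add: deg)
    qed
    have "degree P \<le> N"
      unfolding P_def using deg
      by (intro degree_diff_le) (auto simp: degree_monom_eq)
    moreover have "coeff P N = 0"
      unfolding P_def using lc N by simp
    ultimately have "degree P < N"
      using P0 by (metis le_neq_implies_less leading_coeff_0_iff)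
    moreover have "card (mesh_point N ` {..<N}) \<le> card {x. poly P x = 0}"
    proof (rule card_mono)
      show "finite {x. poly P x = 0}" using P0 by (rule poly_roots_finite)
      show "mesh_point N ` {..<N} \<subseteq> {x. poly P x = 0}"
        by (auto simp: P_def poly_prod poly_monom mesh_power)
    qed
    then have "N \<le> degree P"
      using card_image[OF inj] card_poly_roots_bound[OF P0] by simp
    ultimately show False by simp
  qed
  then have "poly P x = 0" for x by simp
  then have key: "(\<Prod>q<N. x - mesh_point N q) = x ^ N - 1" for x
    by (simp add: P_def poly_prod poly_monom)
  show ?thesis
  proof (cases "c = 0")
    case True
    then show ?thesis using N by simp
  next
    case False
    have "(\<Prod>q<N. z - c * mesh_point N q) = (\<Prod>q<N. c * (z / c - mesh_point N q))"
      using False by (simp add: right_diff_distrib)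
    also have "\<dots> = c ^ N * ((z / c) ^ N - 1)"
      by (simp only: prod.distrib key) simp
    also have "\<dots> = z ^ N - c ^ N"
      using False by (simp add: right_diff_distrib power_divide)
    finally show ?thesis .
  qed
qed

text \<open>
  The zeros of a full mesh are the \<open>N\<close>-th roots of \<open>\<alpha>\<^sup>N\<close>, so their factors multiply up to
  a single factor in \<open>z\<^sup>N\<close>.
\<close>

lemma norm_prod_full_mesh_ge:
  assumes N: "N > 0" and \<alpha>: "0 \<le> \<alpha>" "\<alpha> < 1" and z: "norm z \<le> 1"
  shows "(\<alpha> ^ N - norm z ^ N) / 2 \<le> (\<Prod>q<N. norm (blaschke_factor (of_real \<alpha> * mesh_point N q) z))"
proof -
  have fac: "norm (blaschke_factor (of_real \<alpha> * mesh_point N q) z)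
      = norm (z - of_real \<alpha> * mesh_point N q) / norm (of_real \<alpha> * z - mesh_point N q)" for q
  proof -
    have m: "cnj (mesh_point N q) * mesh_point N q = 1"
      using complex_norm_square[of "mesh_point N q"] by (simp add: mult.commute)
    have "1 - cnj (of_real \<alpha> * mesh_point N q) * z = - (cnj (mesh_point N q) * (of_real \<alpha> * z - mesh_point N q))"
      using m by (simp add: algebra_simps)
    then have "norm (1 - cnj (of_real \<alpha> * mesh_point N q) * z) = norm (of_real \<alpha> * z - mesh_point N q)"
      by (simp only: norm_minus_cancel norm_mult complex_mod_cnj norm_mesh_point)
    moreover have "mesh_point N q \<noteq> 0" by (metis norm_mesh_point norm_zero zero_neq_one)
    ultimately show ?thesis
      by (cases "\<alpha> = 0") (simp_all add: blaschke_factor_def norm_mult norm_divide norm_minus_commute)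
  qed
  have num: "(\<Prod>q<N. norm (z - of_real \<alpha> * mesh_point N q)) = norm (z ^ N - of_real \<alpha> ^ N)"
    using prod_mesh_linear[OF N, of z "of_real \<alpha>"] by (simp add: prod_norm)
  have den: "(\<Prod>q<N. norm (of_real \<alpha> * z - mesh_point N q)) = norm ((of_real \<alpha> * z) ^ N - 1)"
    using prod_mesh_linear[OF N, of "of_real \<alpha> * z" 1] by (simp add: prod_norm)
  have lt: "norm ((of_real \<alpha> * z) ^ N) < 1"
  proof -
    have "\<alpha> * norm z < 1" using \<alpha> z by (metis mult_left_le norm_ge_zero order_le_less_trans)
    then show ?thesis using N \<alpha> by (simp add: norm_power norm_mult power_less_one_iff)
  qed
  have d2: "norm ((of_real \<alpha> * z) ^ N - 1) \<le> 2"
    using norm_triangle_ineq4[of "(of_real \<alpha> * z) ^ N" 1] lt by simp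
  have d0: "norm ((of_real \<alpha> * z) ^ N - 1) > 0" using lt by auto
  have n: "\<alpha> ^ N - norm z ^ N \<le> norm (z ^ N - of_real \<alpha> ^ N)"
    using norm_triangle_ineq3[of "z ^ N" "of_real \<alpha> ^ N"] \<alpha> by (simp add: norm_power)
  have "(\<alpha> ^ N - norm z ^ N) / 2 \<le> norm (z ^ N - of_real \<alpha> ^ N) / 2" using n by simp
  also have "\<dots> \<le> norm (z ^ N - of_real \<alpha> ^ N) / norm ((of_real \<alpha> * z) ^ N - 1)"
    using d2 d0 by (intro divide_left_mono) auto
  also have "\<dots> = (\<Prod>q<N. norm (blaschke_factor (of_real \<alpha> * mesh_point N q) z))"
    unfolding fac prod_dividef num den ..
  finally show ?thesis .
qed

section \<open>Estimates for the defect\<close>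

context blaschke_zeros
begin

lemma norm_prod_at_squared_le_exp:
  assumes z: "norm z < 1" and S: "finite S"
  shows "(norm (prod_at z))\<^sup>2 \<le> exp (- (\<Sum>n\<in>S. blaschke_defect (a n) z))"
proof -
  have "(norm (prod_at z))\<^sup>2 \<le> (\<Prod>k\<in>S. norm (blaschke_factor (a k) z))\<^sup>2"
    by (intro power_mono norm_prod_at_le z S) simp
  also have "\<dots> = (\<Prod>k\<in>S. 1 - blaschke_defect (a k) z)"
    using z norm_zero_less_1
    by (simp add: prod_power_distrib norm_blaschke_factor_squared)
  also have "\<dots> \<le> (\<Prod>k\<in>S. exp (- blaschke_defect (a k) z))"
  proof (rule prod_mono)
    fix k
    show "0 \<le> 1 - blaschke_defect (a k) z \<and> 1 - blaschke_defect (a k) z \<le> exp (- blaschke_defect (a k) z)"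
      using blaschke_defect_le_1[OF norm_zero_less_1, of z k] z exp_ge_add_one_self[of "- blaschke_defect (a k) z"]
      by simp
  qed
  also have "\<dots> = exp (- (\<Sum>n\<in>S. blaschke_defect (a n) z))"
    using S by (simp add: exp_sum sum_negf[symmetric])
  finally show ?thesis .
qed

text \<open>By the Weierstrass product inequality, omitting factors of total defect at most
  \<open>1 / 2\<close> changes the squared modulus by at most a factor 2.\<close>

lemma norm_prod_at_squared_ge:
  assumes z: "norm z < 1" and S: "finite S"
    and small: "\<And>T. finite T \<Longrightarrow> T \<inter> S = {} \<Longrightarrow> (\<Sum>n\<in>T. blaschke_defect (a n) z) \<le> 1 / 2"
  shows "(\<Prod>k\<in>S. norm (blaschke_factor (a k) z))\<^sup>2 / 2 \<le> (norm (prod_at z))\<^sup>2"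
proof (rule LIMSEQ_le_const[OF tendsto_power[OF tendsto_norm[OF prod_at_LIMSEQ[OF z]]]])
  obtain M where M: "S \<subseteq> {..<M}"
    using finite_nat_iff_bounded S by blast
  have "(\<Prod>k\<in>S. norm (blaschke_factor (a k) z))\<^sup>2 / 2 \<le> (norm (\<Prod>k<n. blaschke_factor (a k) z))\<^sup>2"
    if "n \<ge> M" for n
  proof -
    have "S \<subseteq> {..<n}" using M that by auto
    then have eq: "(norm (\<Prod>k<n. blaschke_factor (a k) z))\<^sup>2
        = (\<Prod>k\<in>{..<n} - S. norm (blaschke_factor (a k) z))\<^sup>2 * (\<Prod>k\<in>S. norm (blaschke_factor (a k) z))\<^sup>2"
      by (simp add: prod.subset_diff norm_mult prod_norm power_mult_distrib)
    have "1 / 2 \<le> 1 - (\<Sum>k\<in>{..<n} - S. blaschke_defect (a k) z)"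
      using small[of "{..<n} - S"] by auto
    also have "\<dots> \<le> (\<Prod>k\<in>{..<n} - S. 1 - blaschke_defect (a k) z)"
      using z norm_zero_less_1
      by (intro Weierstrass_prod_ineq) (auto intro!: blaschke_defect_nonneg blaschke_defect_le_1)
    also have "\<dots> = (\<Prod>k\<in>{..<n} - S. norm (blaschke_factor (a k) z))\<^sup>2"
      using z norm_zero_less_1
      by (simp add: prod_power_distrib norm_blaschke_factor_squared)
    finally have "1 / 2 * (\<Prod>k\<in>S. norm (blaschke_factor (a k) z))\<^sup>2
        \<le> (\<Prod>k\<in>{..<n} - S. norm (blaschke_factor (a k) z))\<^sup>2 * (\<Prod>k\<in>S. norm (blaschke_factor (a k) z))\<^sup>2"
      by (intro mult_right_mono) auto
    then show ?thesis unfolding eq by simp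
  qed
  then show "\<exists>N. \<forall>n\<ge>N. (\<Prod>k\<in>S. norm (blaschke_factor (a k) z))\<^sup>2 / 2 \<le> (norm (\<Prod>k<n. blaschke_factor (a k) z))\<^sup>2"
    by blast
qed

end

context
  fixes t s :: real and \<theta> \<zeta> :: complex
  assumes t: "0 < t" "t \<le> 1" and s: "0 < s" "s \<le> 1"
    and \<theta>: "norm \<theta> = 1" and \<zeta>: "norm \<zeta> = 1"
begin

private lemma norm_polar: "norm (of_real (1 - t) * \<theta>) = 1 - t" "norm (of_real (1 - s) * \<zeta>) = 1 - s"
  using t s \<theta> \<zeta> by (simp_all add: norm_mult del: of_real_diff)

private lemma polar_numerator:
  "(1 - (norm (of_real (1 - s) * \<zeta>))\<^sup>2) * (1 - (norm (of_real (1 - t) * \<theta>))\<^sup>2) = s * (2 - s) * (t * (2 - t))"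
  unfolding norm_polar by (simp add: power2_eq_square algebra_simps)

private lemma polar_numerator_le: "s * (2 - s) * (t * (2 - t)) \<le> 4 * s * t"
proof -
  have "s * (2 - s) * (t * (2 - t)) \<le> (s * 2) * (t * 2)"
    using t s by (intro mult_mono) auto
  then show ?thesis by simp
qed

private lemma polar_denominator_ge:
  assumes "0 < D" "D \<le> norm (1 - cnj (of_real (1 - t) * \<theta>) * (of_real (1 - s) * \<zeta>))"
  shows "blaschke_defect (of_real (1 - t) * \<theta>) (of_real (1 - s) * \<zeta>) \<le> 4 * s * t / D\<^sup>2"
  unfolding blaschke_defect_def polar_numerator
  using assms polar_numerator_le t s by (intro frac_le) (auto intro!: power_mono)

text \<open>The denominator is at most \<open>norm (\<theta> - \<zeta>) + t + s\<close>, hence at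
  most \<open>3 * s\<close>; the 9 is its square.\<close>

lemma blaschke_defect_near_ge:
  assumes "t \<le> s" "norm (\<theta> - \<zeta>) \<le> s"
  shows "t / (9 * s) \<le> blaschke_defect (of_real (1 - t) * \<theta>) (of_real (1 - s) * \<zeta>)"
proof -
  let ?d = "1 - cnj (of_real (1 - t) * \<theta>) * (of_real (1 - s) * \<zeta>)"
  have "?d = (1 - cnj \<theta> * \<zeta>) + of_real (1 - (1 - t) * (1 - s)) * (cnj \<theta> * \<zeta>)"
    by (simp add: algebra_simps)
  then have "norm ?d \<le> norm (1 - cnj \<theta> * \<zeta>) + norm (of_real (1 - (1 - t) * (1 - s)) * (cnj \<theta> * \<zeta>))"
    using norm_triangle_ineq by metis
  also have "norm (1 - cnj \<theta> * \<zeta>) = norm (\<theta> - \<zeta>)"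
    by (rule norm_one_minus_cnj_mult_unit[OF \<zeta>])
  also have "norm (of_real (1 - (1 - t) * (1 - s)) * (cnj \<theta> * \<zeta>)) = \<bar>1 - (1 - t) * (1 - s)\<bar>"
    using \<theta> \<zeta> by (simp only: norm_mult norm_of_real complex_mod_cnj mult_1_right)
  also have "\<bar>1 - (1 - t) * (1 - s)\<bar> \<le> t + s"
  proof -
    have "(1 - t) * (1 - s) \<le> 1" using t s by (intro mult_le_one) auto
    moreover have "0 \<le> t * s" using t s by simp
    ultimately show ?thesis by (simp add: algebra_simps)
  qed
  finally have d3: "norm ?d \<le> 3 * s" using assms by simp
  have "norm (of_real (1 - t) * \<theta>) < 1" "norm (of_real (1 - s) * \<zeta>) \<le> 1"
    unfolding norm_polar using t s by auto
  then have "?d \<noteq> 0" by (rule one_minus_cnj_mult_nonzero)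
  then have d0: "norm ?d > 0" by simp
  have "t / (9 * s) = (s * t) / (3 * s)\<^sup>2" using s by (simp add: power2_eq_square field_simps)
  also have "\<dots> \<le> (s * (2 - s) * (t * (2 - t))) / (norm ?d)\<^sup>2"
  proof (intro frac_le)
    have "(s * 1) * (t * 1) \<le> s * (2 - s) * (t * (2 - t))"
      using t s by (intro mult_mono) auto
    then show "s * t \<le> s * (2 - s) * (t * (2 - t))" by simp
    show "(norm ?d)\<^sup>2 \<le> (3 * s)\<^sup>2" using d3 by (intro power_mono) auto
  qed (use d0 t s in auto)
  finally show ?thesis unfolding blaschke_defect_def polar_numerator .
qed

private lemma polar_dist_ge:
  "1 - (1 - t) * (1 - s) \<le> norm (1 - cnj (of_real (1 - t) * \<theta>) * (of_real (1 - s) * \<zeta>))"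
proof -
  have "norm (cnj (of_real (1 - t) * \<theta>) * (of_real (1 - s) * \<zeta>)) = (1 - t) * (1 - s)"
    unfolding norm_mult[of "cnj _"] complex_mod_cnj norm_polar ..
  then show ?thesis
    using norm_triangle_ineq2[of 1 "cnj (of_real (1 - t) * \<theta>) * (of_real (1 - s) * \<zeta>)"] by simp
qed

text \<open>Useful when the zero is much closer to the circle than the point, as for the zeros of
  later levels.\<close>

lemma blaschke_defect_le_depth:
  "blaschke_defect (of_real (1 - t) * \<theta>) (of_real (1 - s) * \<zeta>) \<le> 4 * t / s"
proof -
  have "(1 - t) * (1 - s) \<le> 1 * (1 - s)" using t s by (intro mult_right_mono) auto
  then have "s \<le> 1 - (1 - t) * (1 - s)" by simp
  from order_trans[OF this polar_dist_ge]
  have "s \<le> norm (1 - cnj (of_real (1 - t) * \<theta>) * (of_real (1 - s) * \<zeta>))" .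
  from polar_denominator_ge[OF s(1) this] show ?thesis
    using s by (simp add: power2_eq_square)
qed

text \<open>Useful when the point is much closer to the circle than the zero, as for the zeros of
  earlier levels.\<close>

lemma blaschke_defect_le_height:
  "blaschke_defect (of_real (1 - t) * \<theta>) (of_real (1 - s) * \<zeta>) \<le> 4 * s / t"
proof -
  have "(1 - t) * (1 - s) \<le> (1 - t) * 1" using t s by (intro mult_left_mono) auto
  then have "t \<le> 1 - (1 - t) * (1 - s)" by simp
  from order_trans[OF this polar_dist_ge]
  have "t \<le> norm (1 - cnj (of_real (1 - t) * \<theta>) * (of_real (1 - s) * \<zeta>))" .
  from polar_denominator_ge[OF t(1) this] show ?thesis
    using t by (simp add: power2_eq_square)
qed

text \<open>For zeros of the same level in another direction: moving both points to the circle
  changes the denominator by at most \<open>t + s\<close>, so at least \<open>d / 2\<close> of it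
  remains.\<close>

lemma blaschke_defect_le_far:
  assumes "0 < d" "t \<le> d / 4" "s \<le> d / 4" "d \<le> norm (\<theta> - \<zeta>)"
  shows "blaschke_defect (of_real (1 - t) * \<theta>) (of_real (1 - s) * \<zeta>) \<le> 16 * s * t / d\<^sup>2"
proof -
  let ?d = "1 - cnj (of_real (1 - t) * \<theta>) * (of_real (1 - s) * \<zeta>)"
  have "1 - cnj \<theta> * \<zeta> = ?d - of_real (1 - (1 - t) * (1 - s)) * (cnj \<theta> * \<zeta>)"
    by (simp add: algebra_simps)
  then have "norm (1 - cnj \<theta> * \<zeta>) \<le> norm ?d + norm (of_real (1 - (1 - t) * (1 - s)) * (cnj \<theta> * \<zeta>))"
    using norm_triangle_ineq4 by metis
  also have "norm (of_real (1 - (1 - t) * (1 - s)) * (cnj \<theta> * \<zeta>)) = \<bar>1 - (1 - t) * (1 - s)\<bar>"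
    using \<theta> \<zeta> by (simp only: norm_mult norm_of_real complex_mod_cnj mult_1_right)
  also have "\<bar>1 - (1 - t) * (1 - s)\<bar> \<le> t + s"
  proof -
    have "(1 - t) * (1 - s) \<le> 1" using t s by (intro mult_le_one) auto
    moreover have "0 \<le> t * s" using t s by simp
    ultimately show ?thesis by (simp add: algebra_simps)
  qed
  finally have "d / 2 \<le> norm ?d"
    using assms norm_one_minus_cnj_mult_unit[OF \<zeta>, of \<theta>] by linarith
  from polar_denominator_ge[OF _ this] show ?thesis
    using assms by (simp add: power_divide)
qed

end

section \<open>The level construction\<close>

text \<open>
  Level \<open>k\<close> puts zeros at depth \<open>depth k q\<close> below those of the \<open>N k\<close> mesh points that are
  \<open>\<delta> k\<close>-close to \<open>K\<close>. They are so many that their Poisson sums at radii \<open>1 - r\<close> with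
  \<open>\<delta> (Suc k) \<le> r \<le> \<delta> k\<close> are comparable with the weight, which is \<open>k + 1\<close> except near \<open>F k\<close>, where
  it is only \<open>j k + 1\<close>; at the radius \<open>1 - s k\<close> all other levels are negligible.
\<close>

locale blaschke_levels =
  fixes K :: "complex set" and F :: "nat \<Rightarrow> complex set" and j :: "nat \<Rightarrow> nat"
    and \<delta> s :: "nat \<Rightarrow> real" and N :: "nat \<Rightarrow> nat"
  assumes K: "closed K" "K \<subseteq> sphere 0 1" "K \<noteq> {}"
    and j_le: "j k \<le> k"
    and delta: "0 < \<delta> k" "\<delta> k \<le> 1 / (real k + 1)" "\<delta> (Suc k) \<le> s k"
    and s: "0 < s k" "s k \<le> (\<delta> k)\<^sup>2 / (256 * (real k + 1))" "s (Suc k) \<le> s k"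
    and mass: "real (card {q. q < N (Suc k) \<and> infdist (mesh_point (N (Suc k)) q) K \<le> \<delta> (Suc k)})
      \<le> s k / (64 * 2 ^ Suc k * (real k + 2)) * N (Suc k)"
    and N: "7 * (real k + 1) \<le> N k * \<delta> (Suc k)" "2 * real k + 3 \<le> N k * s k"
      "4 * s (Suc k) * (real (N k))\<^sup>2 \<le> 1 / (32 * 2 ^ k)"
begin

definition weight :: "nat \<Rightarrow> complex \<Rightarrow> real" where
  "weight k \<theta> = (if \<exists>x\<in>F k. dist x \<theta> < \<delta> k then real (j k) + 1 else real k + 1)"

text \<open>Dividing by \<open>N k\<close> makes the sum of the depths over a full mesh of constant
  weight equal to that weight.\<close>

definition depth :: "nat \<Rightarrow> nat \<Rightarrow> real" where
  "depth k q = weight k (mesh_point (N k) q) / N k"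

definition level :: "nat \<Rightarrow> nat set" where
  "level k = {q. q < N k \<and> infdist (mesh_point (N k) q) K \<le> \<delta> k}"

definition level_zero :: "nat \<times> nat \<Rightarrow> complex" where
  "level_zero = (\<lambda>(k, q). of_real (1 - depth k q) * mesh_point (N k) q)"

definition zero_seq :: "nat \<Rightarrow> complex" where
  "zero_seq n = level_zero (from_nat_into (Sigma UNIV level) n)"

lemma finite_level [simp]: "finite (level k)"
  by (simp add: level_def)

lemma delta_le_1: "\<delta> k \<le> 1"
  using delta(2)[of k] by (rule order_trans) simp

lemma s_le_delta: "s k \<le> \<delta> k / 256"
proof -
  have "s k \<le> (\<delta> k)\<^sup>2 / (256 * (real k + 1))" by (rule s(2))
  also have "\<dots> \<le> \<delta> k * 1 / (256 * 1)"
    unfolding power2_eq_square using delta(1)[of k] delta_le_1[of k]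
    by (intro frac_le mult_mono) auto
  finally show ?thesis by simp
qed

lemma delta_Suc_le: "\<delta> (Suc k) \<le> \<delta> k"
  using delta(3)[of k] s_le_delta[of k] delta(1)[of k] by linarith

lemma delta_antimono: "k \<le> l \<Longrightarrow> \<delta> l \<le> \<delta> k"
  by (rule lift_Suc_antimono_le[of \<delta>, OF delta_Suc_le])

lemma s_antimono: "k \<le> l \<Longrightarrow> s l \<le> s k"
  by (rule lift_Suc_antimono_le[of s, OF s(3)])

lemma s_le_1: "s k \<le> 1"
  using s_le_delta[of k] delta_le_1[of k] by simp

lemma N_ge: "7 * (real k + 1) \<le> real (N k)"
proof -
  have "real (N k) * \<delta> (Suc k) \<le> real (N k) * 1"
    using delta_le_1 by (intro mult_left_mono) auto
  then show ?thesis using N(1)[of k] by simp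
qed

lemma N_pos: "0 < N k"
  using N_ge[of k] by (cases "N k") auto

lemma weight_bounds: "1 \<le> weight k \<theta>" "weight k \<theta> \<le> real k + 1"
  using j_le[of k] by (auto simp: weight_def)

lemma depth_ge: "1 / N k \<le> depth k q"
  unfolding depth_def using weight_bounds by (intro divide_right_mono) auto

lemma depth_pos: "0 < depth k q"
  by (rule less_le_trans[OF _ depth_ge]) (simp add: N_pos)

lemma depth_le_weight: "depth k q \<le> (real k + 1) / N k"
  unfolding depth_def using weight_bounds by (intro divide_right_mono) auto

lemma depth_le_delta: "depth k q \<le> \<delta> (Suc k) / 7"
proof -
  have "(real k + 1) / N k \<le> \<delta> (Suc k) / 7"
    using N(1)[of k] N_pos[of k] by (simp add: field_simps)
  then show ?thesis using depth_le_weight order_trans by blast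
qed

lemma depth_le_1: "depth k q \<le> 1 / 7"
  using depth_le_delta[of k q] delta_le_1[of "Suc k"] by simp

lemma norm_level_zero: "norm (level_zero (k, q)) = 1 - depth k q"
  using depth_le_1[of k q] by (simp add: level_zero_def norm_mult del: of_real_diff)

lemma level_mass: "(\<Sum>q\<in>level k. depth k q) \<le> (1 / 2) ^ k"
  and level_mass_Suc: "(\<Sum>q\<in>level (Suc k). depth (Suc k) q) \<le> s k / (64 * 2 ^ Suc k)"
proof -
  have le: "(\<Sum>q\<in>level k. depth k q) \<le> card (level k) * ((real k + 1) / N k)" for k
    using sum_mono[of "level k" "depth k" "\<lambda>_. (real k + 1) / N k"] depth_le_weight by simp
  show mass_Suc: "(\<Sum>q\<in>level (Suc k). depth (Suc k) q) \<le> s k / (64 * 2 ^ Suc k)" for k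
  proof -
    have "(\<Sum>q\<in>level (Suc k). depth (Suc k) q)
        \<le> (s k / (64 * 2 ^ Suc k * (real k + 2)) * N (Suc k)) * ((real (Suc k) + 1) / N (Suc k))"
      using le[of "Suc k"] mass[of k, folded level_def]
      by (rule order_trans[OF _ mult_right_mono]) simp
    \<comment> \<open>The factor \<open>k + 2\<close> in \<open>mass\<close> is the largest weight
      possible on level \<open>Suc k\<close> and cancels here.\<close>
    also have "\<dots> = s k / (64 * 2 ^ Suc k)"
      using N_pos[of "Suc k"] by (simp add: divide_simps)
    finally show ?thesis .
  qed
  show "(\<Sum>q\<in>level k. depth k q) \<le> (1 / 2) ^ k"
  proof (cases k)
    case 0
    \<comment> \<open>\<open>mass\<close> speaks of successor levels only. On level 0 it suffices to
      count all \<open>N 0\<close> mesh points, with depth at most \<open>1 / N 0\<close>.\<close>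
    have "card (level 0) \<le> card {..<N 0}" by (intro card_mono) (auto simp: level_def)
    then have "real (card (level 0)) * ((real 0 + 1) / N 0) \<le> real (N 0) * ((real 0 + 1) / N 0)"
      by (intro mult_right_mono) auto
    from order_trans[OF le[of 0] this] show ?thesis using N_pos[of 0] 0 by simp
  next
    case (Suc l)
    have "s l / (64 * 2 ^ Suc l) \<le> 1 / (1 * 2 ^ Suc l)"
      using s_le_1[of l] s(1)[of l] by (intro frac_le mult_right_mono) auto
    then show ?thesis using mass_Suc[of l] Suc by (simp add: power_one_over)
  qed
qed

lemma near_subset_level:
  assumes "\<zeta> \<in> K" "r \<le> \<delta> k"
  shows "{q. q < N k \<and> norm (mesh_point (N k) q - \<zeta>) \<le> r} \<subseteq> level k"
proof (clarsimp simp: level_def)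
  fix q assume "norm (mesh_point (N k) q - \<zeta>) \<le> r"
  then show "infdist (mesh_point (N k) q) K \<le> \<delta> k"
    using infdist_le[OF assms(1), of "mesh_point (N k) q"] assms(2) by (simp add: dist_norm)
qed

text \<open>This makes the set of zero indices infinite, so that \<open>from_nat_into\<close>
  enumerates it bijectively and each zero enters the sequence once per index.\<close>

lemma level_nonempty: "level k \<noteq> {}"
proof -
  obtain \<zeta> where \<zeta>: "\<zeta> \<in> K" using K by blast
  have "N k * \<delta> (Suc k) / 16 \<le> card {q. q < N k \<and> norm (mesh_point (N k) q - \<zeta>) \<le> \<delta> (Suc k)}"
  proof (rule card_mesh_near_ge)
    have "7 * (real k + 1) \<ge> 7" by simp
    then show "7 \<le> real (N k) * \<delta> (Suc k)" using N(1)[of k] by linarith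
  qed (use \<zeta> K delta(1) delta_le_1 in auto)
  moreover have "0 < N k * \<delta> (Suc k) / 16" using N_pos delta(1) by simp
  ultimately have "card {q. q < N k \<and> norm (mesh_point (N k) q - \<zeta>) \<le> \<delta> (Suc k)} \<noteq> 0"
    by (intro notI) simp
  then have "{q. q < N k \<and> norm (mesh_point (N k) q - \<zeta>) \<le> \<delta> (Suc k)} \<noteq> {}"
    by (intro notI) simp
  then show ?thesis using near_subset_level[OF \<zeta> delta_Suc_le] by blast
qed

lemma bij_zero_index: "bij_betw (from_nat_into (Sigma UNIV level)) UNIV (Sigma UNIV level)"
proof (rule bij_betw_from_nat_into)
  have "fst ` (Sigma UNIV level) = UNIV" using level_nonempty by force
  then show "infinite (Sigma UNIV level)"
    by (metis finite_imageI infinite_UNIV_nat)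
qed simp

lemma sum_Sigma_le:
  assumes "finite X" "X \<subseteq> Sigma UNIV level" "\<And>x. x \<in> Sigma UNIV level \<Longrightarrow> 0 \<le> (f x :: real)"
    and "\<And>k. (\<Sum>q\<in>{q \<in> level k. (k, q) \<in> X}. f (k, q)) \<le> g k"
  obtains M where "(\<Sum>x\<in>X. f x) \<le> (\<Sum>k<M. g k)"
proof -
  obtain M where M: "fst ` X \<subseteq> {..<M}"
    using finite_nat_iff_bounded assms(1) by blast
  have "X = Sigma {..<M} (\<lambda>k. {q \<in> level k. (k, q) \<in> X})"
    using M assms(2) by fastforce
  then have "(\<Sum>x\<in>X. f x) = (\<Sum>k<M. \<Sum>q\<in>{q \<in> level k. (k, q) \<in> X}. f (k, q))"
    by (simp add: sum.Sigma)
  also have "\<dots> \<le> (\<Sum>k<M. g k)" by (intro sum_mono assms(4))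
  finally show thesis by (rule that)
qed

lemma sum_half_powers_le: "(\<Sum>k<M. (1 / 2) ^ k) \<le> (2::real)"
proof -
  have "(\<Sum>k<M. (1 / 2) ^ k) \<le> (\<Sum>k. (1 / 2 :: real) ^ k)"
    by (intro sum_le_suminf summable_geometric) auto
  then show ?thesis by (simp add: suminf_geometric)
qed

sublocale blaschke_zeros zero_seq
proof
  let ?e = "from_nat_into (Sigma UNIV level)"
  show lt: "norm (zero_seq n) < 1" for n
    using depth_pos norm_level_zero unfolding zero_seq_def by (cases "?e n") simp
  have "(\<Sum>n<m. 1 - norm (zero_seq n)) \<le> 2" for m
  proof -
    have inj: "inj_on ?e {..<m}"
      using bij_zero_index by (auto simp: bij_betw_def intro: inj_on_subset)
    have sub: "?e ` {..<m} \<subseteq> Sigma UNIV level"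
      using bij_zero_index by (auto simp: bij_betw_def)
    have "(\<Sum>n<m. 1 - norm (zero_seq n)) = (\<Sum>x\<in>?e ` {..<m}. 1 - norm (level_zero x))"
      by (simp add: sum.reindex[OF inj] zero_seq_def)
    also obtain M where "\<dots> \<le> (\<Sum>k<M. (1 / 2) ^ k)"
    proof (rule sum_Sigma_le[OF _ sub, of "\<lambda>x. 1 - norm (level_zero x)" "\<lambda>k. (1 / 2) ^ k"])
      show "0 \<le> 1 - norm (level_zero x)" for x
        using depth_pos norm_level_zero by (cases x) (simp add: less_imp_le)
      show "(\<Sum>q\<in>{q \<in> level k. (k, q) \<in> ?e ` {..<m}}. 1 - norm (level_zero (k, q))) \<le> (1 / 2) ^ k" for k
      proof -
        have "(\<Sum>q\<in>{q \<in> level k. (k, q) \<in> ?e ` {..<m}}. depth k q) \<le> (\<Sum>q\<in>level k. depth k q)"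
          using depth_pos by (intro sum_mono2) (auto simp: less_imp_le)
        with level_mass[of k] show ?thesis by (simp add: norm_level_zero)
      qed
    qed auto
    also have "\<dots> \<le> 2" by (rule sum_half_powers_le)
    finally show ?thesis .
  qed
  then show "summable (\<lambda>n. 1 - norm (zero_seq n))"
    using lt by (intro summableI_nonneg_bounded) (auto simp: less_imp_le)
qed

lemma index_preimage:
  assumes "finite X" "X \<subseteq> Sigma UNIV level"
  obtains S where "finite S" "bij_betw (from_nat_into (Sigma UNIV level)) S X"
proof -
  let ?e = "from_nat_into (Sigma UNIV level)"
  let ?S = "?e -` X"
  have inj: "inj ?e" using bij_zero_index by (simp add: bij_betw_def)
  have "?e ` ?S = X" using bij_zero_index assms(2) by (auto simp: bij_betw_def)
  then have "bij_betw ?e ?S X" using inj by (auto simp: bij_betw_def intro: inj_on_subset)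
  moreover have "finite ?S" using assms(1) inj by (rule finite_vimageI)
  ultimately show thesis using that by blast
qed

lemma norm_prod_levels_squared_le_exp:
  assumes z: "norm z < 1" and X: "finite X" "X \<subseteq> Sigma UNIV level"
  shows "(norm (prod_at z))\<^sup>2 \<le> exp (- (\<Sum>x\<in>X. blaschke_defect (level_zero x) z))"
proof -
  obtain S where S: "finite S" "bij_betw (from_nat_into (Sigma UNIV level)) S X"
    using index_preimage[OF X] .
  show ?thesis
    using norm_prod_at_squared_le_exp[OF z S(1)]
      sum.reindex_bij_betw[OF S(2), of "\<lambda>x. blaschke_defect (level_zero x) z"]
    by (simp add: zero_seq_def)
qed

lemma norm_prod_levels_squared_ge:
  assumes z: "norm z < 1" and X: "finite X" "X \<subseteq> Sigma UNIV level"
    and small: "\<And>T. finite T \<Longrightarrow> T \<subseteq> Sigma UNIV level - X \<Longrightarrow> (\<Sum>x\<in>T. blaschke_defect (level_zero x) z) \<le> 1 / 2"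
  shows "(\<Prod>x\<in>X. norm (blaschke_factor (level_zero x) z))\<^sup>2 / 2 \<le> (norm (prod_at z))\<^sup>2"
proof -
  let ?e = "from_nat_into (Sigma UNIV level)"
  obtain S where S: "finite S" "bij_betw ?e S X"
    using index_preimage[OF X] .
  have inj: "inj ?e" using bij_zero_index by (simp add: bij_betw_def)
  have "(\<Prod>k\<in>S. norm (blaschke_factor (zero_seq k) z))\<^sup>2 / 2 \<le> (norm (prod_at z))\<^sup>2"
  proof (rule norm_prod_at_squared_ge[OF z S(1)])
    fix T assume T: "finite T" "T \<inter> S = {}"
    have inT: "inj_on ?e T" using inj by (rule inj_on_subset) simp
    have "?e ` T \<subseteq> Sigma UNIV level - X"
    proof
      fix x assume "x \<in> ?e ` T"
      then obtain n where n: "n \<in> T" "x = ?e n" by auto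
      have "x \<in> Sigma UNIV level" using n bij_zero_index by (auto simp: bij_betw_def)
      moreover have "x \<notin> X"
      proof
        assume "x \<in> X"
        then obtain n' where "n' \<in> S" "x = ?e n'" using S(2) by (auto simp: bij_betw_def)
        then have "n \<in> S" using n inj by (auto dest: injD)
        then show False using T n by auto
      qed
      ultimately show "x \<in> Sigma UNIV level - X" by simp
    qed
    from small[OF _ this] show "(\<Sum>n\<in>T. blaschke_defect (zero_seq n) z) \<le> 1 / 2"
      using T by (simp add: sum.reindex[OF inT] zero_seq_def)
  qed
  then show ?thesis
    using prod.reindex_bij_betw[OF S(2), of "\<lambda>x. norm (blaschke_factor (level_zero x) z)"]
    by (simp add: zero_seq_def)
qed

lemma norm_radius:
  assumes "\<zeta> \<in> K" "0 < r" "r \<le> 1"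
  shows "norm (of_real (1 - r) * \<zeta>) < 1"
  using assms K by (auto simp: norm_mult simp del: of_real_diff)

text \<open>At least \<open>N k * r / 16\<close> zeros of level \<open>k\<close> lie in directions
  within \<open>r\<close> of \<zeta>, and each contributes a defect of at least
  \<open>(W / N k) / (9 * r)\<close>. The product of the two is \<open>W / 144\<close>, independent
  of \<open>r\<close>.\<close>

lemma norm_prod_at_le_weight:
  assumes \<zeta>: "\<zeta> \<in> K" and r: "\<delta> (Suc k) \<le> r" "r \<le> \<delta> k"
    and W: "\<And>\<theta>. norm (\<theta> - \<zeta>) \<le> r \<Longrightarrow> W \<le> weight k \<theta>"
  shows "(norm (prod_at (of_real (1 - r) * \<zeta>)))\<^sup>2 \<le> exp (- W / 144)"
proof -
  have n\<zeta>: "norm \<zeta> = 1" using \<zeta> K by auto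
  have r0: "0 < r" "r \<le> 1" using r delta(1)[of "Suc k"] delta_le_1[of k] by auto
  define Q where "Q = {q. q < N k \<and> norm (mesh_point (N k) q - \<zeta>) \<le> r}"
  let ?d = "\<lambda>q. blaschke_defect (level_zero (k, q)) (of_real (1 - r) * \<zeta>)"
  have QL: "Q \<subseteq> level k" unfolding Q_def by (rule near_subset_level[OF \<zeta> r(2)])
  then have fQ: "finite Q" using finite_subset finite_level by blast
  have Nr: "7 \<le> N k * r"
  proof -
    have "7 * (real k + 1) \<le> N k * \<delta> (Suc k)" by (rule N(1))
    also have "\<dots> \<le> N k * r" using r by (intro mult_left_mono) auto
    finally show ?thesis by simp
  qed
  have card: "N k * r / 16 \<le> card Q"
    unfolding Q_def by (rule card_mesh_near_ge[OF n\<zeta> r0 Nr])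
  have each: "1 / (9 * r) * (W / N k) \<le> ?d q" if "q \<in> Q" for q
  proof -
    have "W / N k \<le> depth k q"
      unfolding depth_def using W that by (intro divide_right_mono) (auto simp: Q_def)
    then have "1 / (9 * r) * (W / N k) \<le> 1 / (9 * r) * depth k q"
      using r0 by (intro mult_left_mono) auto
    also have "\<dots> = depth k q / (9 * r)" by simp
    also have "\<dots> \<le> ?d q"
      unfolding level_zero_def split_conv
    proof (rule blaschke_defect_near_ge)
      show "depth k q \<le> r" using depth_le_delta[of k q] r delta(1)[of "Suc k"] by linarith
    qed (use depth_pos depth_le_1[of k q] r0 n\<zeta> that in \<open>auto simp: Q_def\<close>)
    finally show ?thesis .
  qed
  show ?thesis
  proof (cases "W \<ge> 0")
    case False
    then have "(norm (prod_at (of_real (1 - r) * \<zeta>)))\<^sup>2 \<le> 1"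
      using norm_prod_at_le_1[OF norm_radius[OF \<zeta> r0]] by (simp add: power_le_one)
    also have "\<dots> \<le> exp (- W / 144)" using False by simp
    finally show ?thesis .
  next
    case True
    have "W / 144 = (N k * r / 16) * (1 / (9 * r) * (W / N k))"
      using r0 N_pos[of k] by simp
    also have "\<dots> \<le> card Q * (1 / (9 * r) * (W / N k))"
      using True r0 by (intro mult_right_mono card) auto
    also have "\<dots> \<le> (\<Sum>q\<in>Q. ?d q)"
      using sum_mono[OF each] by simp
    also have "\<dots> = (\<Sum>x\<in>Pair k ` Q. blaschke_defect (level_zero x) (of_real (1 - r) * \<zeta>))"
      by (simp add: sum.reindex inj_on_def)
    finally have ge: "W / 144 \<le> (\<Sum>x\<in>Pair k ` Q. blaschke_defect (level_zero x) (of_real (1 - r) * \<zeta>))" .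
    have "(norm (prod_at (of_real (1 - r) * \<zeta>)))\<^sup>2
        \<le> exp (- (\<Sum>x\<in>Pair k ` Q. blaschke_defect (level_zero x) (of_real (1 - r) * \<zeta>)))"
      using QL fQ by (intro norm_prod_levels_squared_le_exp norm_radius \<zeta> r0) auto
    also have "\<dots> \<le> exp (- W / 144)" using ge by simp
    finally show ?thesis .
  qed
qed

end

section \<open>Lower bound for the modulus at points of \<open>F k\<close>\<close>

lemma exp_minus_double_le:
  fixes x :: real
  assumes "0 \<le> x" "x \<le> 1 / 2"
  shows "exp (- (2 * x)) \<le> 1 - x"
proof -
  have "1 \<le> (1 - x) * (1 + 2 * x)"
    using mult_nonneg_nonneg[of x "1 - 2 * x"] assms by (simp add: algebra_simps)
  also have "\<dots> \<le> (1 - x) * exp (2 * x)"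
    using assms exp_ge_add_one_self[of "2 * x"] by (intro mult_left_mono) auto
  finally show ?thesis by (simp add: exp_minus field_simps)
qed

context blaschke_levels
begin

lemma defect_nonneg_level:
  assumes "norm z < 1"
  shows "0 \<le> blaschke_defect (level_zero x) z"
proof (cases x)
  case (Pair k q)
  have "norm (level_zero (k, q)) < 1" using norm_level_zero depth_pos by simp
  then show ?thesis using assms Pair by (simp add: blaschke_defect_nonneg)
qed

text \<open>All mesh points within \<open>\<delta> k\<close> of a point of \<open>F k\<close> have
  the same weight, so the zeros below them belong to one uniform mesh. Filling in the rest of that
  mesh only lowers the product, and the full mesh is evaluated exactly.\<close>

lemma prod_near_level_ge:
  assumes \<zeta>: "\<zeta> \<in> K" "\<zeta> \<in> F k"
    and Q: "Q \<subseteq> {q. q < N k \<and> norm (mesh_point (N k) q - \<zeta>) < \<delta> k}"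
  shows "exp (- (2 * (real (j k) + 1))) / 4
    \<le> (\<Prod>q\<in>Q. norm (blaschke_factor (level_zero (k, q)) (of_real (1 - s k) * \<zeta>)))"
proof -
  define w where "w = real (j k) + 1"
  define \<alpha> where "\<alpha> = 1 - w / N k"
  have w: "1 \<le> w" "w \<le> real k + 1" using j_le[of k] by (auto simp: w_def)
  have Np: "real (N k) > 0" using N_pos[of k] by simp
  have x: "0 < w / N k" "w / N k \<le> 1 / 2"
    using w N_ge[of k] Np by (auto simp: field_simps)
  have \<alpha>: "0 \<le> \<alpha>" "\<alpha> < 1" using x unfolding \<alpha>_def by linarith+
  have n\<zeta>: "norm \<zeta> = 1" using \<zeta> K by auto
  have nz: "norm (of_real (1 - s k) * \<zeta>) = 1 - s k"
    using n\<zeta> s_le_1[of k] by (simp add: norm_mult del: of_real_diff)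
  let ?f = "\<lambda>q. norm (blaschke_factor (of_real \<alpha> * mesh_point (N k) q) (of_real (1 - s k) * \<zeta>))"
  have f1: "?f q \<le> 1" for q
  proof (rule norm_blaschke_factor_le_1)
    show "norm (of_real \<alpha> * mesh_point (N k) q) < 1" using \<alpha> by (simp add: norm_mult)
    show "norm (of_real (1 - s k) * \<zeta>) \<le> 1" unfolding nz using s(1)[of k] by simp
  qed
  have "exp (- (2 * w)) = exp (- (2 * (w / N k))) ^ N k"
    using Np by (simp add: exp_of_nat_mult[symmetric])
  also have "\<dots> \<le> \<alpha> ^ N k"
    unfolding \<alpha>_def using x by (intro power_mono exp_minus_double_le) auto
  finally have \<alpha>N: "exp (- (2 * w)) \<le> \<alpha> ^ N k" .
  have "(1 - s k) ^ N k \<le> exp (- s k) ^ N k"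
    using s_le_1[of k] exp_ge_add_one_self[of "- s k"] by (intro power_mono) auto
  also have "\<dots> = exp (- (N k * s k))" by (simp add: exp_of_nat_mult[symmetric])
  \<comment> \<open>The bound \<open>2 * k + 3\<close> in \<open>N\<close> equals
    \<open>2 * (k + 1) + 1\<close> with \<open>w \<le> k + 1\<close>; the extra 1 makes this power
    at most half of the lower bound for \<open>\<alpha> ^ N k\<close>.\<close>
  also have "\<dots> \<le> exp (- (2 * w) - 1)" using N(2)[of k] w by simp
  also have "\<dots> = exp (- (2 * w)) / exp 1" by (simp add: exp_diff)
  also have "\<dots> \<le> exp (- (2 * w)) / 2"
    using exp_ge_add_one_self[of 1] by (intro divide_left_mono) auto
  finally have "exp (- (2 * w)) / 4 \<le> (\<alpha> ^ N k - norm (of_real (1 - s k) * \<zeta>) ^ N k) / 2"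
    unfolding nz
  proof -
    assume "(1 - s k) ^ N k \<le> exp (- (2 * w)) / 2"
    moreover have "E / 4 \<le> (x - y) / 2" if "y \<le> E / 2" "E \<le> x" for E x y :: real
      using that by simp
    ultimately show "exp (- (2 * w)) / 4 \<le> (\<alpha> ^ N k - (1 - s k) ^ N k) / 2"
      using \<alpha>N by blast
  qed
  also have "\<dots> \<le> (\<Prod>q<N k. ?f q)"
    by (rule norm_prod_full_mesh_ge[OF N_pos \<alpha>]) (use nz s(1)[of k] in simp)
  also have "\<dots> = (\<Prod>q\<in>{..<N k} - Q. ?f q) * (\<Prod>q\<in>Q. ?f q)"
    using Q by (intro prod.subset_diff) auto
  also have "\<dots> \<le> 1 * (\<Prod>q\<in>Q. ?f q)"
    using f1 by (intro mult_right_mono prod_le_1 prod_nonneg) auto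
  also have "(\<Prod>q\<in>Q. ?f q) = (\<Prod>q\<in>Q. norm (blaschke_factor (level_zero (k, q)) (of_real (1 - s k) * \<zeta>)))"
  proof (intro prod.cong refl)
    fix q assume "q \<in> Q"
    then have "weight k (mesh_point (N k) q) = w"
      using Q \<zeta>(2) by (auto simp: weight_def w_def dist_norm norm_minus_commute)
    then show "?f q = norm (blaschke_factor (level_zero (k, q)) (of_real (1 - s k) * \<zeta>))"
      by (simp add: level_zero_def depth_def \<alpha>_def)
  qed
  finally show ?thesis by (simp add: w_def)
qed

text \<open>The nearby zeros of level \<open>k\<close> give \<open>exp (- 2 * w) / 4\<close> with
  \<open>w = j k + 1\<close>; squaring yields 16, and all other zeros together cost one more factor
  2.\<close>

lemma norm_prod_at_ge:
  assumes \<zeta>: "\<zeta> \<in> K" "\<zeta> \<in> F k"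
  shows "exp (- (4 * (real (j k) + 1))) / 32 \<le> (norm (prod_at (of_real (1 - s k) * \<zeta>)))\<^sup>2"
proof -
  let ?z = "of_real (1 - s k) * \<zeta>"
  define Q where "Q = {q \<in> level k. norm (mesh_point (N k) q - \<zeta>) < \<delta> k}"
  let ?X = "Pair k ` Q"
  let ?d = "\<lambda>x. blaschke_defect (level_zero x) ?z"
  have n\<zeta>: "norm \<zeta> = 1" using \<zeta> K by auto
  have z: "norm ?z < 1" by (rule norm_radius[OF \<zeta>(1) s(1) s_le_1])
  note polar = depth_pos _ s(1) s_le_1 norm_mesh_point n\<zeta>
  have d1: "depth i q \<le> 1" for i q using depth_le_1[of i q] by simp
  have "(\<Prod>x\<in>?X. norm (blaschke_factor (level_zero x) ?z))\<^sup>2 / 2 \<le> (norm (prod_at ?z))\<^sup>2"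
  proof (rule norm_prod_levels_squared_ge[OF z])
    show "finite ?X" "?X \<subseteq> Sigma UNIV level" by (auto simp: Q_def)
    fix T assume T: "finite T" "T \<subseteq> Sigma UNIV level - ?X"
    define g where "g i = (1 / 2) ^ i / 16 + (if i = k then 1 / 16 else 0 :: real)" for i
    have level_sum: "(\<Sum>q\<in>{q \<in> level i. (i, q) \<in> T}. ?d (i, q)) \<le> g i" for i
    proof -
      let ?L = "{q \<in> level i. (i, q) \<in> T}"
      have "card ?L \<le> card {..<N i}" by (rule card_mono) (auto simp: level_def)
      then have cardL: "real (card ?L) \<le> N i" by simp
      have Np: "real (N i) > 0" using N_pos[of i] by simp
      \<comment> \<open>Zeros of earlier levels lie far deeper than \<open>s k\<close>; on level
        \<open>k\<close> only zeros in directions at least \<open>\<delta> k\<close> away remain;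
        later levels have total depth far below \<open>s k\<close>.\<close>
      consider "i < k" | "i = k" | l where "i = Suc l" "k \<le> l"
        by (metis less_Suc_eq_le linorder_neqE_nat not0_implies_Suc not_less_zero)
      then show ?thesis
      proof cases
        case 1
        have "?d (i, q) \<le> 4 * s k * N i" for q
        proof -
          have "?d (i, q) \<le> 4 * s k / depth i q"
            unfolding level_zero_def split_conv by (rule blaschke_defect_le_height) (use polar d1 in auto)
          also have "\<dots> \<le> 4 * s k / (1 / N i)"
            using depth_ge[of i q] depth_pos[of i q] s(1)[of k] Np by (intro divide_left_mono) auto
          finally show ?thesis by simp
        qed
        then have "(\<Sum>q\<in>?L. ?d (i, q)) \<le> card ?L * (4 * s k * N i)"
          using sum_mono[of ?L "\<lambda>q. ?d (i, q)" "\<lambda>_. 4 * s k * N i"] by simp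
        also have "\<dots> \<le> N i * (4 * s k * N i)"
          using cardL s(1)[of k] by (intro mult_right_mono) auto
        also have "\<dots> = 4 * s k * (real (N i))\<^sup>2" by (simp add: power2_eq_square)
        also have "\<dots> \<le> 4 * s (Suc i) * (real (N i))\<^sup>2"
          using s_antimono[of "Suc i" k] 1 by (intro mult_right_mono) auto
        also have "\<dots> \<le> 1 / (32 * 2 ^ i)" by (rule N(3))
        also have "\<dots> \<le> g i" using 1 by (simp add: g_def power_one_over divide_simps)
        finally show ?thesis .
      next
        case 2
        have "?d (i, q) \<le> 16 * s k * ((real k + 1) / N k) / (\<delta> k)\<^sup>2" if "q \<in> ?L" for q
        proof -
          have far: "\<delta> k \<le> norm (mesh_point (N k) q - \<zeta>)"
          proof -
            have "(k, q) \<notin> ?X" using that T(2) 2 by blast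
            then show ?thesis using that 2 by (auto simp: Q_def not_less)
          qed
          have "depth k q \<le> \<delta> k / 4"
            using depth_le_delta[of k q] delta_Suc_le[of k] delta(1)[of k] delta(1)[of "Suc k"] by linarith
          moreover have "s k \<le> \<delta> k / 4"
            using s_le_delta[of k] delta(1)[of k] by linarith
          ultimately have "?d (k, q) \<le> 16 * s k * depth k q / (\<delta> k)\<^sup>2"
            unfolding level_zero_def split_conv
            using far by (intro blaschke_defect_le_far) (use polar d1 delta(1) in auto)
          also have "\<dots> \<le> 16 * s k * ((real k + 1) / N k) / (\<delta> k)\<^sup>2"
            using s(1)[of k] depth_le_weight[of k q] by (intro divide_right_mono mult_left_mono) auto
          finally show ?thesis using 2 by simp
        qed
        then have "(\<Sum>q\<in>?L. ?d (i, q)) \<le> card ?L * (16 * s k * ((real k + 1) / N k) / (\<delta> k)\<^sup>2)"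
          using sum_mono[of ?L "\<lambda>q. ?d (i, q)" "\<lambda>_. 16 * s k * ((real k + 1) / N k) / (\<delta> k)\<^sup>2"] by simp
        also have "\<dots> \<le> N k * (16 * s k * ((real k + 1) / N k) / (\<delta> k)\<^sup>2)"
          using cardL 2 s(1)[of k] by (intro mult_right_mono) auto
        also have "\<dots> = 16 * (real k + 1) / (\<delta> k)\<^sup>2 * s k"
          using Np 2 by simp
        also have "\<dots> \<le> 16 * (real k + 1) / (\<delta> k)\<^sup>2 * ((\<delta> k)\<^sup>2 / (256 * (real k + 1)))"
          by (intro mult_left_mono s(2)) auto
        also have "\<dots> = 1 / 16"
        proof -
          have "16 * A / D * (D / (256 * A)) = 1 / 16" if "A > 0" "D > 0" for A D :: real
            using that by (simp add: field_simps)
          then show ?thesis using delta(1)[of k] by simp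
        qed
        also have "\<dots> \<le> g i" using 2 by (simp add: g_def)
        finally show ?thesis .
      next
        case 3
        have "?d (i, q) \<le> 4 * depth i q / s k" for q
          unfolding level_zero_def split_conv by (rule blaschke_defect_le_depth) (use polar d1 in auto)
        then have "(\<Sum>q\<in>?L. ?d (i, q)) \<le> (\<Sum>q\<in>?L. 4 / s k * depth i q)"
          by (intro sum_mono) simp
        also have "\<dots> \<le> (\<Sum>q\<in>level i. 4 / s k * depth i q)"
          using s(1)[of k] depth_pos by (intro sum_mono2) (auto simp: less_imp_le)
        also have "\<dots> = 4 / s k * (\<Sum>q\<in>level i. depth i q)" by (simp add: sum_distrib_left)
        also have "\<dots> \<le> 4 / s k * (s l / (64 * 2 ^ i))"
          using s(1)[of k] level_mass_Suc[of l] 3 by (intro mult_left_mono) auto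
        also have "\<dots> \<le> 4 / s k * (s k / (64 * 2 ^ i))"
          using s(1)[of k] s_antimono[of k l] 3 by (intro mult_left_mono divide_right_mono) auto
        also have "\<dots> = (1 / 2) ^ i / 16"
          using s(1)[of k] by (simp add: power_one_over)
        also have "\<dots> \<le> g i" by (simp add: g_def)
        finally show ?thesis .
      qed
    qed
    obtain M where M: "(\<Sum>x\<in>T. ?d x) \<le> (\<Sum>i<M. g i)"
      by (rule sum_Sigma_le[OF T(1) _ _ level_sum]) (use T(2) z defect_nonneg_level in auto)
    also have "(\<Sum>i<M. g i) = (\<Sum>i<M. (1 / 2) ^ i) / 16 + (\<Sum>i<M. if i = k then 1 / 16 else 0)"
      by (simp add: g_def sum.distrib sum_divide_distrib)
    also have "(\<Sum>i<M. if i = k then 1 / 16 else 0) \<le> (1 / 16 :: real)" by simp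
    also have "(\<Sum>i<M. (1 / 2) ^ i) / 16 \<le> (2 / 16 :: real)"
      using sum_half_powers_le[of M] by (intro divide_right_mono) auto
    finally show "(\<Sum>x\<in>T. ?d x) \<le> 1 / 2" by simp
  qed
  moreover have "(exp (- (2 * (real (j k) + 1))) / 4)\<^sup>2
      \<le> (\<Prod>x\<in>?X. norm (blaschke_factor (level_zero x) ?z))\<^sup>2"
  proof (intro power_mono)
    have "(\<Prod>x\<in>?X. norm (blaschke_factor (level_zero x) ?z))
        = (\<Prod>q\<in>Q. norm (blaschke_factor (level_zero (k, q)) ?z))"
      by (simp add: prod.reindex inj_on_def)
    then show "exp (- (2 * (real (j k) + 1))) / 4 \<le> (\<Prod>x\<in>?X. norm (blaschke_factor (level_zero x) ?z))"
      using prod_near_level_ge[OF \<zeta>, of Q] by (auto simp: Q_def level_def)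
  qed simp
  moreover have "(exp (- (2 * (real (j k) + 1))) / 4)\<^sup>2 = exp (- (4 * (real (j k) + 1))) / 16"
    by (simp add: power_divide exp_double[symmetric])
  ultimately show ?thesis by linarith
qed

section \<open>Radial and unrestricted limits of the constructed product\<close>

lemma delta_tendsto_0: "\<delta> \<longlonglongrightarrow> 0"
proof (rule tendsto_sandwich[of "\<lambda>_. 0" \<delta> _ "\<lambda>k. 1 / (real k + 1)"])
  show "(\<lambda>k. 1 / (real k + 1)) \<longlonglongrightarrow> 0"
    using LIMSEQ_inverse_real_of_nat by (simp add: inverse_eq_divide add.commute)
  show "eventually (\<lambda>k. 0 \<le> \<delta> k) sequentially" "eventually (\<lambda>k. \<delta> k \<le> 1 / (real k + 1)) sequentially"
    using delta(1,2) by (auto simp: less_imp_le)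
qed simp

lemma s_tendsto_0: "s \<longlonglongrightarrow> 0"
proof (rule tendsto_sandwich[of "\<lambda>_. 0" s _ "\<lambda>k. \<delta> k / 256"])
  show "(\<lambda>k. \<delta> k / 256) \<longlonglongrightarrow> 0" using tendsto_divide[OF delta_tendsto_0 tendsto_const, of 256] by simp
  show "eventually (\<lambda>k. 0 \<le> s k) sequentially" "eventually (\<lambda>k. s k \<le> \<delta> k / 256) sequentially"
    using s(1) s_le_delta by (auto simp: less_imp_le)
qed simp

lemma radial_limit_along:
  assumes L: "((\<lambda>r. prod_at (of_real r * \<zeta>)) \<longlongrightarrow> L) (at_left 1)"
    and r: "r \<longlonglongrightarrow> 0" "\<And>k. 0 < r k"
  shows "(\<lambda>k. (norm (prod_at (of_real (1 - r k) * \<zeta>)))\<^sup>2) \<longlonglongrightarrow> (norm L)\<^sup>2"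
proof -
  have "r k \<noteq> 0" for k using r(2)[of k] by simp
  then have "filterlim (\<lambda>k. 1 - r k) (at_left 1) sequentially"
    unfolding filterlim_at using r tendsto_diff[OF tendsto_const r(1), of 1] by auto
  from filterlim_compose[OF L this] show ?thesis
    by (intro tendsto_power tendsto_norm) (simp add: o_def)
qed

text \<open>Along the radii \<open>1 - \<delta> k\<close> with \<open>F k = {}\<close> the weight is
  \<open>k + 1\<close>, so a limit would have to be 0. Along \<open>1 - s k\<close> with
  \<open>j k = i\<close> and \<zeta> in \<open>F k\<close> the modulus has a positive lower bound
  depending on \<open>i\<close> only.\<close>

lemma no_radial_limit:
  assumes \<zeta>: "\<zeta> \<in> K" and inf: "infinite {k. j k = i \<and> \<zeta> \<in> F k}" and empty: "infinite {k. F k = {}}"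
  shows "\<not> has_radial_limit_at prod_at \<zeta>"
proof
  assume "has_radial_limit_at prod_at \<zeta>"
  then obtain L where L: "((\<lambda>r. prod_at (of_real r * \<zeta>)) \<longlongrightarrow> L) (at_left 1)"
    by (auto simp: has_radial_limit_at_def)
  have "(norm L)\<^sup>2 \<le> 0"
  proof (rule ccontr)
    assume "\<not> (norm L)\<^sup>2 \<le> 0"
    then have L0: "0 < (norm L)\<^sup>2 / 2" "(norm L)\<^sup>2 / 2 < (norm L)\<^sup>2" by auto
    have "eventually (\<lambda>k. (norm L)\<^sup>2 / 2 < (norm (prod_at (of_real (1 - \<delta> k) * \<zeta>)))\<^sup>2) sequentially"
      using radial_limit_along[OF L delta_tendsto_0 delta(1)] L0(2) by (rule order_tendstoD)
    moreover have "(\<lambda>k. exp (- (real k + 1) / 144)) \<longlonglongrightarrow> 0"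
      by real_asymp
    then have "eventually (\<lambda>k. exp (- (real k + 1) / 144) < (norm L)\<^sup>2 / 2) sequentially"
      using L0(1) by (rule order_tendstoD)
    ultimately have "eventually (\<lambda>k. F k \<noteq> {}) sequentially"
    proof eventually_elim
      case (elim k)
      show "F k \<noteq> {}"
      proof
        assume "F k = {}"
        then have "weight k \<theta> = real k + 1" for \<theta> by (simp add: weight_def)
        then have "(norm (prod_at (of_real (1 - \<delta> k) * \<zeta>)))\<^sup>2 \<le> exp (- (real k + 1) / 144)"
          using delta_Suc_le by (intro norm_prod_at_le_weight \<zeta>) auto
        with elim show False by linarith
      qed
    qed
    then have "finite {k. F k = {}}"
      by (simp add: cofinite_eq_sequentially[symmetric] eventually_cofinite)
    with empty show False by contradiction
  qed
  then have "(norm L)\<^sup>2 < exp (- (4 * (real i + 1))) / 32"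
    by (rule le_less_trans) simp
  with radial_limit_along[OF L s_tendsto_0 s(1)]
  have "eventually (\<lambda>k. (norm (prod_at (of_real (1 - s k) * \<zeta>)))\<^sup>2 < exp (- (4 * (real i + 1))) / 32) sequentially"
    by (rule order_tendstoD)
  then have "eventually (\<lambda>k. \<not> (j k = i \<and> \<zeta> \<in> F k)) sequentially"
  proof eventually_elim
    case (elim k)
    then show ?case using norm_prod_at_ge[OF \<zeta>, of k] by auto
  qed
  then have "finite {k. j k = i \<and> \<zeta> \<in> F k}"
    by (simp add: cofinite_eq_sequentially[symmetric] eventually_cofinite)
  with inf show False by contradiction
qed

text \<open>A reduced weight at a mesh point within \<open>\<delta> k\<close> of \<zeta> means that
  \<open>F k\<close> comes within \<open>2 * \<delta> k\<close> of \<zeta>. For each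
  \<open>W\<close> this happens with \<open>j k < W\<close> for finitely many \<open>k\<close> only,
  so the weights near \<zeta> eventually reach \<open>W\<close>.\<close>

lemma radial_limit_0:
  assumes \<zeta>: "\<zeta> \<in> K" and fin: "\<And>i. finite {k. j k = i \<and> (\<exists>x\<in>F k. dist x \<zeta> < 2 * \<delta> k)}"
  shows "((\<lambda>r. prod_at (of_real r * \<zeta>)) \<longlongrightarrow> 0) (at_left 1)"
proof -
  have bound: "eventually (\<lambda>r. (norm (prod_at (of_real r * \<zeta>)))\<^sup>2 \<le> exp (- real W / 144)) (at_left 1)" for W :: nat
  proof -
    have "finite (\<Union>i<W. {k. j k = i \<and> (\<exists>x\<in>F k. dist x \<zeta> < 2 * \<delta> k)})"
      using fin by blast
    then obtain k1 where k1: "(\<Union>i<W. {k. j k = i \<and> (\<exists>x\<in>F k. dist x \<zeta> < 2 * \<delta> k)}) \<subseteq> {..<k1}"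
      using finite_nat_iff_bounded by blast
    define k0 where "k0 = max k1 W"
    have weight: "real W \<le> weight k \<theta>" if "k0 \<le> k" "norm (\<theta> - \<zeta>) \<le> \<delta> k" for k \<theta>
    proof (cases "j k < W")
      case True
      then have no: "\<not> (\<exists>x\<in>F k. dist x \<zeta> < 2 * \<delta> k)"
        using k1 that(1) by (force simp: k0_def)
      have "\<not> (\<exists>x\<in>F k. dist x \<theta> < \<delta> k)"
      proof
        assume "\<exists>x\<in>F k. dist x \<theta> < \<delta> k"
        then obtain x where "x \<in> F k" "dist x \<theta> < \<delta> k" by blast
        then have "dist x \<zeta> < 2 * \<delta> k"
          using that(2) dist_triangle[of x \<zeta> \<theta>] by (simp add: dist_norm[of \<theta>])
        with no \<open>x \<in> F k\<close> show False by blast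
      qed
      then show ?thesis using that(1) by (simp add: weight_def k0_def)
    next
      case False
      then show ?thesis using that(1) by (auto simp: weight_def k0_def)
    qed
    have "(norm (prod_at (of_real r * \<zeta>)))\<^sup>2 \<le> exp (- real W / 144)" if r: "1 - \<delta> k0 < r" "r < 1" for r
    proof -
      have "eventually (\<lambda>k. \<delta> k < 1 - r) sequentially"
        using r by (intro order_tendstoD(2)[OF delta_tendsto_0]) simp
      then have "\<exists>k. \<delta> k < 1 - r"
        using eventually_happens'[OF sequentially_bot] by blast
      \<comment> \<open>The least such index is a successor \<open>Suc k\<close>; minimality places
        \<open>1 - r\<close> between \<open>\<delta> (Suc k)\<close> and \<open>\<delta> k\<close>,
        the range handled by level \<open>k\<close>.\<close>
      then have small: "\<delta> (LEAST k. \<delta> k < 1 - r) < 1 - r" by (rule LeastI_ex)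
      have gt: "k0 < (LEAST k. \<delta> k < 1 - r)"
      proof (rule ccontr)
        assume "\<not> k0 < (LEAST k. \<delta> k < 1 - r)"
        then have "\<delta> k0 \<le> \<delta> (LEAST k. \<delta> k < 1 - r)" by (intro delta_antimono) simp
        then show False using small r by linarith
      qed
      then obtain k where k: "(LEAST k. \<delta> k < 1 - r) = Suc k" by (cases "LEAST k. \<delta> k < 1 - r") auto
      have "\<not> \<delta> k < 1 - r" using not_less_Least[of k "\<lambda>k. \<delta> k < 1 - r"] k by simp
      then have r': "\<delta> (Suc k) \<le> 1 - r" "1 - r \<le> \<delta> k" using small k by auto
      have "k0 \<le> k" using gt k by simp
      from norm_prod_at_le_weight[OF \<zeta> r', of "real W"] weight[OF this] r'
      show ?thesis by (metis diff_diff_eq2 add_diff_cancel_left' order_trans)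
    qed
    moreover have "1 - \<delta> k0 < 1" using delta(1) by simp
    ultimately show ?thesis unfolding eventually_at_left_field by blast
  qed
  show ?thesis
  proof (rule tendstoI)
    fix e :: real assume e: "e > 0"
    have "(\<lambda>W. exp (- real W / 144)) \<longlonglongrightarrow> 0" by real_asymp
    moreover have "0 < e\<^sup>2" using e by simp
    ultimately have "eventually (\<lambda>W. exp (- real W / 144) < e\<^sup>2) sequentially"
      by (rule order_tendstoD)
    then obtain W where W: "exp (- real W / 144) < e\<^sup>2"
      using eventually_happens'[OF sequentially_bot] by blast
    from bound[of W] show "eventually (\<lambda>r. dist (prod_at (of_real r * \<zeta>)) 0 < e) (at_left 1)"
    proof eventually_elim
      case (elim r)
      with W have "(norm (prod_at (of_real r * \<zeta>)))\<^sup>2 < e\<^sup>2" by simp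
      then show ?case using e by (simp add: power_less_imp_less_base[of _ 2])
    qed
  qed
qed

text \<open>Zeros of level \<open>k\<close> lie within \<open>2 * \<delta> k\<close> of
  \<open>K\<close>, so only finitely many levels, each of them finite, reach a small disc about
  \<zeta>.\<close>

lemma unrestricted_limit_off_K:
  assumes \<zeta>: "norm \<zeta> = 1" "\<zeta> \<notin> K"
  shows "has_unrestricted_limit_at prod_at \<zeta>"
proof -
  let ?e = "from_nat_into (Sigma UNIV level)"
  define d where "d = infdist \<zeta> K / 2"
  have "infdist \<zeta> K \<noteq> 0" using in_closed_iff_infdist_zero[OF K(1,3)] \<zeta>(2) by simp
  then have d: "d > 0" using infdist_nonneg[of \<zeta> K] by (simp add: d_def)
  have "eventually (\<lambda>k. \<delta> k < d / 2) sequentially"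
    using d by (intro order_tendstoD(2)[OF delta_tendsto_0]) simp
  then obtain k0 where k0: "\<And>k. k \<ge> k0 \<Longrightarrow> \<delta> k < d / 2"
    by (auto simp: eventually_sequentially)
  have "{n. norm (zero_seq n - \<zeta>) < d} \<subseteq> ?e -` (Sigma {..<k0} level)"
  proof
    fix n assume n: "n \<in> {n. norm (zero_seq n - \<zeta>) < d}"
    obtain k q where kq: "?e n = (k, q)" by (cases "?e n")
    have "?e n \<in> Sigma UNIV level" using bij_zero_index by (auto simp: bij_betw_def)
    then have q: "q \<in> level k" using kq by simp
    have zn: "zero_seq n = of_real (1 - depth k q) * mesh_point (N k) q"
      by (simp add: zero_seq_def kq level_zero_def)
    have "mesh_point (N k) q - zero_seq n = of_real (depth k q) * mesh_point (N k) q"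
      unfolding zn by (simp add: algebra_simps)
    then have "norm (mesh_point (N k) q - zero_seq n) = depth k q"
      using depth_pos[of k q] by (simp add: norm_mult)
    also have "\<dots> \<le> \<delta> k"
      using depth_le_delta[of k q] delta_Suc_le[of k] delta(1)[of "Suc k"] by linarith
    finally have m: "norm (mesh_point (N k) q - zero_seq n) \<le> \<delta> k" .
    have "2 * d \<le> infdist (mesh_point (N k) q) K + norm (\<zeta> - mesh_point (N k) q)"
      using infdist_triangle[of \<zeta> K "mesh_point (N k) q"] by (simp add: d_def dist_norm)
    also have "norm (\<zeta> - mesh_point (N k) q) \<le> norm (zero_seq n - \<zeta>) + norm (mesh_point (N k) q - zero_seq n)"
      using norm_triangle_ineq[of "zero_seq n - \<zeta>" "mesh_point (N k) q - zero_seq n"]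
      by (simp add: norm_minus_commute)
    finally have "2 * d < \<delta> k + d + \<delta> k" using n m q by (auto simp: level_def)
    then have "\<not> k0 \<le> k" using k0[of k] by auto
    then show "n \<in> ?e -` (Sigma {..<k0} level)" using kq q by auto
  qed
  moreover have "finite (?e -` (Sigma {..<k0} level))"
    using bij_zero_index by (intro finite_vimageI) (auto simp: bij_betw_def)
  ultimately have "finite {n. norm (zero_seq n - \<zeta>) < d}" by (rule finite_subset)
  then show ?thesis by (rule unrestricted_limit_if_finitely_many_near[OF \<zeta>(1) d])
qed

lemma no_unrestricted_limit_if_radial_0:
  assumes \<zeta>: "norm \<zeta> = 1" and lim0: "((\<lambda>r. prod_at (of_real r * \<zeta>)) \<longlongrightarrow> 0) (at_left 1)"
  shows "\<not> has_unrestricted_limit_at prod_at \<zeta>"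
proof
  assume "has_unrestricted_limit_at prod_at \<zeta>"
  then obtain L where L: "(prod_at \<longlongrightarrow> L) (at \<zeta> within ball 0 1)"
    by (auto simp: has_unrestricted_limit_at_def)
  have "L = 0"
    using tendsto_unique[OF trivial_limit_at_left_real unrestricted_limit_imp_radial_limit[OF \<zeta> L] lim0] .
  with norm_unrestricted_limit[OF \<zeta> L] show False by simp
qed

end

section \<open>Choice of parameters\<close>

text \<open>The order of choice decides: \<open>N k\<close> must be large relative to
  \<open>\<delta> (Suc k)\<close>, and \<open>s (Suc k)\<close> small relative to
  \<open>N k\<close>. So stage \<open>k\<close> fixes \<open>\<delta> k\<close>, \<open>s k\<close>
  and \<open>N (k - 1)\<close>, and carries a tolerance \<open>e\<close> for the mesh count near
  \<open>K\<close>, which holds for all large meshes and is called in when \<open>N k\<close> is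
  chosen.\<close>

lemma blaschke_levels_parameters:
  assumes K: "closed K" "K \<subseteq> sphere 0 1" "K \<noteq> {}" and null: "K \<in> null_sets arc_length"
    and j_le: "\<And>k. j k \<le> k" and \<eta>: "\<And>k. \<eta> k > 0"
  obtains \<delta> s N where "blaschke_levels K j \<delta> s N" "\<And>k. 2 * \<delta> k \<le> \<eta> k"
proof -
  define c where "c d n = real (card {q. q < n \<and> infdist (mesh_point n q) K \<le> d})" for d n
  define P where "P k = (\<lambda>(d, t, e, n::nat). 0 < d \<and> d \<le> 1 / (real k + 1) \<and> 2 * d \<le> \<eta> k \<and>
      0 < t \<and> t \<le> d\<^sup>2 / (256 * (real k + 1)) \<and> eventually (\<lambda>n. c d n \<le> e * real n) sequentially)" for k
  define R where "R k = (\<lambda>(d, t, e, _::nat) (d', t', e', n).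
      d' \<le> t \<and> t' \<le> t \<and> e' = t / (64 * 2 ^ Suc k * (real k + 2)) \<and>
      c d n \<le> e * real n \<and> 7 * (real k + 1) \<le> real n * d' \<and> 2 * real k + 3 \<le> real n * t \<and>
      4 * t' * (real n)\<^sup>2 \<le> 1 / (32 * 2 ^ k))" for k
  have small: "\<exists>d. 0 < d \<and> d \<le> b \<and> eventually (\<lambda>n. c d n \<le> e * real n) sequentially"
    if be: "0 < b" "0 < e" for b e :: real
  proof -
    obtain d0 where d0: "d0 > 0" "eventually (\<lambda>n. c d0 n \<le> e * real n) sequentially"
      using card_mesh_near_null_set[OF K null be(2)] unfolding c_def .
    have "c (min d0 b) n \<le> c d0 n" for n
      unfolding c_def of_nat_le_iff by (rule card_mono) auto
    note le = this
    have "eventually (\<lambda>n. c (min d0 b) n \<le> e * real n) sequentially"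
      using d0(2) by eventually_elim (rule order_trans[OF le])
    then show ?thesis using d0(1) be by (intro exI[of _ "min d0 b"]) auto
  qed
  have "\<exists>x. P 0 x"
  proof -
    obtain d where d: "0 < d" "d \<le> min 1 (\<eta> 0 / 2)" "eventually (\<lambda>n. c d n \<le> 1 * real n) sequentially"
      using small[of "min 1 (\<eta> 0 / 2)" 1] \<eta>[of 0] by auto
    \<comment> \<open>Tolerance 1 asks nothing of the first mesh count, and the last entry 0 is a
      placeholder, as no level precedes level 0.\<close>
    then have "P 0 (d, d\<^sup>2 / 256, 1, 0)" by (auto simp: P_def)
    then show ?thesis by blast
  qed
  moreover have "\<exists>y. P (Suc k) y \<and> R k x y" if "P k x" for k x
  proof -
    obtain d t e m where x: "x = (d, t, e, m)" by (cases x) auto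
    have px: "0 < d" "d \<le> 1 / (real k + 1)" "2 * d \<le> \<eta> k" "0 < t"
        "eventually (\<lambda>n. c d n \<le> e * real n) sequentially"
      using that by (auto simp: P_def x)
    define e' where "e' = t / (64 * 2 ^ Suc k * (real k + 2))"
    have e': "e' > 0" using px by (simp add: e'_def)
    define b where "b = min t (min (1 / (real (Suc k) + 1)) (\<eta> (Suc k) / 2))"
    have "b > 0" using px \<eta>[of "Suc k"] by (simp add: b_def)
    then obtain d' where d': "0 < d'" "d' \<le> b" "eventually (\<lambda>n. c d' n \<le> e' * real n) sequentially"
      using small e' by blast
    have large: "eventually (\<lambda>n. C \<le> real n * u) sequentially" if "u > 0" for C u :: real
    proof -
      have "eventually (\<lambda>n. C / u \<le> real n) sequentially"
        using filterlim_real_sequentially by (auto simp: filterlim_at_top)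
      then show ?thesis by eventually_elim (use that in \<open>simp add: divide_le_eq\<close>)
    qed
    have "eventually (\<lambda>n. c d n \<le> e * real n \<and> 7 * (real k + 1) \<le> real n * d' \<and> 2 * real k + 3 \<le> real n * t) sequentially"
      using px(5) large[OF d'(1), of "7 * (real k + 1)"] large[OF px(4), of "2 * real k + 3"]
      by eventually_elim simp
    then obtain n where n: "c d n \<le> e * real n" "7 * (real k + 1) \<le> real n * d'" "2 * real k + 3 \<le> real n * t"
      using eventually_happens'[OF sequentially_bot] by blast
    have n0: "real n > 0"
    proof (rule ccontr)
      assume "\<not> real n > 0"
      then have "real n = 0" by simp
      with n(2) show False by (simp only:) simp
    qed
    \<comment> \<open>In turn: \<open>s\<close> decreases, the distant zeros of the same level
      become negligible, and so do all \<open>n\<close> zeros of the preceding mesh, whose depth is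
      at least \<open>1 / n\<close>.\<close>
    define t' where "t' = min t (min (d'\<^sup>2 / (256 * (real (Suc k) + 1))) (1 / (128 * 2 ^ k * (real n)\<^sup>2)))"
    have t': "t' > 0" using px d' n0 by (simp add: t'_def)
    have "4 * t' * (real n)\<^sup>2 \<le> 4 * (1 / (128 * 2 ^ k * (real n)\<^sup>2)) * (real n)\<^sup>2"
      by (intro mult_right_mono mult_left_mono) (auto simp: t'_def)
    also have "\<dots> = 1 / (32 * 2 ^ k)" using n0 by simp
    finally have "R k x (d', t', e', n)"
      using d' n by (auto simp: R_def x e'_def t'_def b_def)
    moreover have "P (Suc k) (d', t', e', n)"
      using d' t' by (auto simp: P_def b_def t'_def)
    ultimately show ?thesis by blast
  qed
  ultimately obtain f where "\<forall>k. P k (f k) \<and> R k (f k) (f (Suc k))"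
    using dependent_nat_choice[of P R] by blast
  then have Pf: "\<And>k. P k (f k)" and Rf: "\<And>k. R k (f k) (f (Suc k))" by auto
  define \<delta> where "\<delta> k = fst (f k)" for k
  define s where "s k = fst (snd (f k))" for k
  define e where "e k = fst (snd (snd (f k)))" for k
  \<comment> \<open>The mesh of level \<open>k\<close> is chosen at stage \<open>k + 1\<close>,
    together with \<open>\<delta> (Suc k)\<close> and \<open>s (Suc k)\<close>.\<close>
  define N where "N k = snd (snd (snd (f (Suc k))))" for k
  have P': "0 < \<delta> k" "\<delta> k \<le> 1 / (real k + 1)" "2 * \<delta> k \<le> \<eta> k" "0 < s k"
      "s k \<le> (\<delta> k)\<^sup>2 / (256 * (real k + 1))" for k
    using Pf[of k] by (auto simp: P_def \<delta>_def s_def split: prod.splits)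
  have R': "\<delta> (Suc k) \<le> s k" "s (Suc k) \<le> s k" "e (Suc k) = s k / (64 * 2 ^ Suc k * (real k + 2))"
      "c (\<delta> k) (N k) \<le> e k * real (N k)" "7 * (real k + 1) \<le> real (N k) * \<delta> (Suc k)"
      "2 * real k + 3 \<le> real (N k) * s k" "4 * s (Suc k) * (real (N k))\<^sup>2 \<le> 1 / (32 * 2 ^ k)" for k
    using Rf[of k] by (auto simp: R_def \<delta>_def s_def e_def N_def split: prod.splits)
  have "blaschke_levels K j \<delta> s N"
  proof
    show "real (card {q. q < N (Suc k) \<and> infdist (mesh_point (N (Suc k)) q) K \<le> \<delta> (Suc k)})
      \<le> s k / (64 * 2 ^ Suc k * (real k + 2)) * real (N (Suc k))" for k
      using R'(4)[of "Suc k"] unfolding R'(3) c_def .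
  qed (use K j_le P' R' in auto)
  with P'(3) show thesis using that by blast
qed

section \<open>Existence of the product and the equivalence\<close>

lemma exists_blaschke_product:
  assumes K: "closed K" "K \<subseteq> sphere 0 1" "K \<noteq> {}" and null: "K \<in> null_sets arc_length"
    and E: "E \<subseteq> K" "gdelta_sigma_in (top_of_set (sphere 0 1)) E"
  obtains B where "is_blaschke_product B"
    "{\<zeta> \<in> sphere 0 1. \<not> has_radial_limit_at B \<zeta>} = E"
    "{\<zeta> \<in> sphere 0 1. has_unrestricted_limit_at B \<zeta>} = sphere 0 1 - K"
proof -
  obtain F :: "nat \<Rightarrow> complex set" and j :: "nat \<Rightarrow> nat" and \<eta> :: "nat \<Rightarrow> real" where
    \<eta>: "\<And>k. \<eta> k > 0" and j_le: "\<And>k. j k \<le> k" and empty: "infinite {k. F k = {}}"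
    and inE: "\<And>x. x \<in> E \<Longrightarrow> \<exists>i. infinite {k. j k = i \<and> x \<in> F k}"
    and outE: "\<And>x i. x \<in> sphere 0 1 - E \<Longrightarrow> finite {k. j k = i \<and> (\<exists>y\<in>F k. dist y x < \<eta> k)}"
    by (rule gdelta_sigma_shells[OF E(2) bounded_sphere]) (rule that)
  obtain \<delta> s N where levels: "blaschke_levels K j \<delta> s N" and \<delta>\<eta>: "\<And>k. 2 * \<delta> k \<le> \<eta> k"
    by (rule blaschke_levels_parameters[where j = j and \<eta> = \<eta>, OF K null j_le \<eta>]) (rule that)
  interpret blaschke_levels K F j \<delta> s N by (rule levels)
  have on_circle: "norm \<zeta> = 1" if "\<zeta> \<in> K" for \<zeta> using that K(2) by auto
  have no_rad: "\<not> has_radial_limit_at prod_at \<zeta>" if "\<zeta> \<in> E" for \<zeta>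
    using inE[OF that] no_radial_limit[OF _ _ empty] that E(1) by blast
  have lim0: "((\<lambda>r. prod_at (of_real r * \<zeta>)) \<longlongrightarrow> 0) (at_left 1)" if "\<zeta> \<in> K - E" for \<zeta>
  proof (rule radial_limit_0)
    fix i
    have "\<zeta> \<in> sphere 0 1 - E" using that K by auto
    from outE[OF this, of i] show "finite {k. j k = i \<and> (\<exists>x\<in>F k. dist x \<zeta> < 2 * \<delta> k)}"
      by (rule finite_subset[rotated]) (use \<delta>\<eta> in \<open>auto intro: less_le_trans\<close>)
  qed (use that in simp)
  have unr: "has_unrestricted_limit_at prod_at \<zeta>" if "norm \<zeta> = 1" "\<zeta> \<notin> K" for \<zeta>
    by (rule unrestricted_limit_off_K[OF that])
  have rad: "has_radial_limit_at prod_at \<zeta>" if "norm \<zeta> = 1" "\<zeta> \<notin> E" for \<zeta>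
    using lim0[of \<zeta>] has_unrestricted_imp_has_radial_limit[OF that(1) unr[OF that(1)]] that(2)
    by (auto simp: has_radial_limit_at_def)
  have no_unr: "\<not> has_unrestricted_limit_at prod_at \<zeta>" if "\<zeta> \<in> K" for \<zeta>
  proof -
    show ?thesis
    proof (cases "\<zeta> \<in> E")
      case True
      then show ?thesis using no_rad has_unrestricted_imp_has_radial_limit on_circle[OF that] by blast
    next
      case False
      then show ?thesis using lim0[of \<zeta>] that no_unrestricted_limit_if_radial_0 on_circle by simp
    qed
  qed
  show thesis
  proof (rule that)
    show "is_blaschke_product prod_at"
      unfolding is_blaschke_product_iff using blaschke_zeros_axioms by blast
    show "{\<zeta> \<in> sphere 0 1. \<not> has_radial_limit_at prod_at \<zeta>} = E"
      using no_rad rad on_circle E(1) by (auto simp: subset_iff)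
    show "{\<zeta> \<in> sphere 0 1. has_unrestricted_limit_at prod_at \<zeta>} = sphere 0 1 - K"
      using no_unr unr by auto
  qed
qed

theorem theorem17:
  fixes E1 E2 :: "complex set"
  assumes "E1 \<subseteq> E2" and "E2 \<subseteq> sphere 0 1"
    and "E2 \<in> null_sets arc_length"
    and "E2 \<noteq> {}"
  shows "(\<exists>B. is_blaschke_product B \<and>
            {\<zeta> \<in> sphere 0 1. \<not> has_radial_limit_at B \<zeta>} = E1 \<and>
            {\<zeta> \<in> sphere 0 1. has_unrestricted_limit_at B \<zeta>} = sphere 0 1 - E2)
         \<longleftrightarrow>
         closed E2 \<and>
         gdelta_sigma_in (top_of_set (sphere 0 1)) E1 \<and> E1 \<in> null_sets arc_length"
proof
  assume "\<exists>B. is_blaschke_product B \<and>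
            {\<zeta> \<in> sphere 0 1. \<not> has_radial_limit_at B \<zeta>} = E1 \<and>
            {\<zeta> \<in> sphere 0 1. has_unrestricted_limit_at B \<zeta>} = sphere 0 1 - E2"
  then obtain B where B: "is_blaschke_product B"
    and E1: "E1 = {\<zeta> \<in> sphere 0 1. \<not> has_radial_limit_at B \<zeta>}"
    and unr: "{\<zeta> \<in> sphere 0 1. has_unrestricted_limit_at B \<zeta>} = sphere 0 1 - E2" by blast
  obtain a where "blaschke_zeros a" and eq: "\<And>z. z \<in> ball 0 1 \<Longrightarrow> B z = blaschke_zeros.prod_at a z"
    using B unfolding is_blaschke_product_iff by blast
  then interpret blaschke_zeros a by simp
  have "E2 = sphere 0 1 - {\<zeta> \<in> sphere 0 1. has_unrestricted_limit_at B \<zeta>}"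
    unfolding unr using assms(2) by (simp add: double_diff)
  also have "\<dots> = {\<zeta> \<in> sphere 0 1. \<not> has_unrestricted_limit_at prod_at \<zeta>}"
    by (auto simp only: has_unrestricted_limit_at_cong[of B prod_at, OF eq])
  finally have "E2 = {\<zeta> \<in> sphere 0 1. \<not> has_unrestricted_limit_at prod_at \<zeta>}" .
  then have "closed E2" using closed_no_unrestricted_limit by simp
  moreover have "E1 = {\<zeta> \<in> sphere 0 1. \<not> has_radial_limit_at prod_at \<zeta>}"
    unfolding E1 using has_radial_limit_at_cong[of B prod_at, OF eq] by auto
  then have "gdelta_sigma_in (top_of_set (sphere 0 1)) E1"
    using gdelta_sigma_no_radial_limit[OF holomorphic_on_imp_continuous_on[OF holomorphic_prod_at]] by simp
  \<comment> \<open>The measure is complete, so \<open>E1\<close> inherits nullity from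
    \<open>E2\<close>.\<close>
  moreover have "E1 \<in> null_sets arc_length"
    using assms(1,3) unfolding arc_length_def by (rule null_sets_completion_subset)
  ultimately show "closed E2 \<and> gdelta_sigma_in (top_of_set (sphere 0 1)) E1 \<and> E1 \<in> null_sets arc_length"
    by blast
next
  assume "closed E2 \<and> gdelta_sigma_in (top_of_set (sphere 0 1)) E1 \<and> E1 \<in> null_sets arc_length"
  then show "\<exists>B. is_blaschke_product B \<and>
            {\<zeta> \<in> sphere 0 1. \<not> has_radial_limit_at B \<zeta>} = E1 \<and>
            {\<zeta> \<in> sphere 0 1. has_unrestricted_limit_at B \<zeta>} = sphere 0 1 - E2"
    using exists_blaschke_product[OF _ assms(2,4,3,1)] by metis
qed

end
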